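(* Let $f_1,\ldots,f_N$ be a minimal set of generators of $\mathbb{R}[x_1,\ldots,x_m]^G$ and write $f=(f_1,\ldots,f_N):W\to\mathbb{R}^N$. Let $P\in\mathcal{M}_*^G$, put $s_n(k)=\int_W f_n^k\,\mathrm{d}P$ for $1\le n\le N$, $k\in\mathbb{N}$, and assume that for each $n=1,\ldots,N$ Carleman's condition holds: $$\sum_{k=1}^\infty \frac{1}{s_n(2k)^{1/2k}}=\infty .$$ Then $P$ is determinate by its $G$-invariant moments (i.e. $P$ is $G$-determinate). Moreover, for every $1\le p<\infty$, the space $\mathbb{C}[x_1,\ldots,x_m]^G$ is dense in $L_p^G(W,P)$, and for every $1\le p<\infty$ and every $S\subset\mathbb{R}^N$ which is somewhere dense, the space $\mathrm{Span}_{\mathbb{C}}\{\mathrm{e}^{\mathrm{i}\langle\lambda,f\rangle} : \lambda\in S\}$ is dense in $L_p^G(W,P)$.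
   Context: $W=\mathbb{R}^m$ and $G$ is a finite subgroup of $GL(m,\mathbb{R})$ acting linearly on $W$. $G$ acts on functions on $W$ by $(gh)(v)=h(g^{-1}v)$ and on positive Borel measures on $W$ by $(gP)(B)=P(g^{-1}B)$; an object is $G$-invariant if it is fixed by every $g\in G$. $\mathbb{R}[x_1,\ldots,x_m]^G$ and $\mathbb{C}[x_1,\ldots,x_m]^G$ are the algebras of $G$-invariant polynomials with real, respectively complex, coefficients. Polynomials $f_1,\ldots,f_N\in\mathbb{R}[x_1,\ldots,x_m]^G$ generate $\mathbb{R}[x_1,\ldots,x_m]^G$ if every $G$-invariant real polynomial is a polynomial in $f_1,\ldots,f_N$; the generating system is minimal if no proper subset generates. $\mathbb{N}=\{0,1,2,\ldots\}$; multi-index notation: $x^\alpha=x_1^{\alpha(1)}\cdots x_m^{\alpha(m)}$ for $\alpha\in\mathbb{N}^m$ and $f^\alpha=f_1^{\alpha(1)}\cdots f_N^{\alpha(N)}$ for $\alpha\in\mathbb{N}^N$. $\mathcal{M}_*^G$ is the set of $G$-invariant positive Borel measures $P$ on $W$ with $\int_W |x^\alpha|\,\mathrm{d}P<\infty$ for all $\alpha\in\mathbb{N}^m$. The $G$-invariant moments of $P$ are $s_\alpha(P)=\int_W f^\alpha\,\mathrm{d}P$, $\alpha\in\mathbb{N}^N$. $P\in\mathcal{M}_*^G$ is $G$-determinate (determinate by $G$-invariant moments) if no other measure $Q\in\mathcal{M}_*^G$ satisfies $s_\alpha(Q)=s_\alpha(P)$ for all $\alpha\in\mathbb{N}^N$.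 $L_p^G(W,P)$ is the subspace of $G$-invariant elements of the complex space $L_p(W,P)$. A set $S\subset\mathbb{R}^N$ is somewhere dense if its closure has non-empty interior. $\langle\cdot,\cdot\rangle$ is the standard inner product on $\mathbb{R}^N$. In Carleman's condition a term with $s_n(2k)=0$ is read as $1/0=\infty$. *)

theory Defs
  imports "HOL-Analysis.Analysis"
begin

definition finite_linear_group :: "(real ^ 'm ^ 'm) set \<Rightarrow> bool" where
  "finite_linear_group G \<longleftrightarrow>
     finite G \<and> mat 1 \<in> G \<and>
     (\<forall>g\<in>G. \<forall>h\<in>G. g ** h \<in> G) \<and>
     (\<forall>g\<in>G. invertible g \<and> matrix_inv g \<in> G)"

definition invariant_fun :: "(real ^ 'm ^ 'm) set \<Rightarrow> (real ^ 'm \<Rightarrow> 'b) \<Rightarrow> bool" where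
  "invariant_fun G h \<longleftrightarrow> (\<forall>g\<in>G. \<forall>v. h (matrix_inv g *v v) = h v)"

definition invariant_measure :: "(real ^ 'm ^ 'm) set \<Rightarrow> (real ^ 'm) measure \<Rightarrow> bool" where
  "invariant_measure G P \<longleftrightarrow>
     (\<forall>g\<in>G. \<forall>B\<in>sets borel. emeasure P ((\<lambda>v. matrix_inv g *v v) ` B) = emeasure P B)"

(* Polynomials are identified with the polynomial functions they define, which is harmless
   over the infinite fields of real and complex numbers. *)
definition real_invariant_polys :: "(real ^ 'm ^ 'm) set \<Rightarrow> (real ^ 'm \<Rightarrow> real) set" where
  "real_invariant_polys G = {p. real_polynomial_function p \<and> invariant_fun G p}"

definition complex_invariant_polys :: "(real ^ 'm ^ 'm) set \<Rightarrow> (real ^ 'm \<Rightarrow> complex) set" where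
  "complex_invariant_polys G = {p. polynomial_function p \<and> invariant_fun G p}"

(* For complex values, the library's polynomial_function means a polynomial in the real
   coordinates with complex coefficients. *)
lemma polynomial_function_complex_iff:
  fixes p :: "real ^ 'm \<Rightarrow> complex"
  shows "polynomial_function p \<longleftrightarrow>
    (\<exists>a b. real_polynomial_function a \<and> real_polynomial_function b \<and>
           p = (\<lambda>v. complex_of_real (a v) + \<i> * complex_of_real (b v)))"
proof
  assume "polynomial_function p"
  then have "real_polynomial_function (\<lambda>v. Re (p v))" "real_polynomial_function (\<lambda>v. Im (p v))"
    unfolding polynomial_function_def
    using bounded_linear_Re bounded_linear_Im by (auto simp: o_def)
  then show "\<exists>a b. real_polynomial_function a \<and> real_polynomial_function b \<and>
      p = (\<lambda>v. complex_of_real (a v) + \<i> * complex_of_real (b v))"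
    using complex_eq by blast
next
  assume "\<exists>a b. real_polynomial_function a \<and> real_polynomial_function b \<and>
      p = (\<lambda>v. complex_of_real (a v) + \<i> * complex_of_real (b v))"
  then show "polynomial_function p"
    by (auto simp: polynomial_function_iff_Basis_inner Basis_complex_def inner_complex_def)
qed

definition monom_at :: "real ^ 'n \<Rightarrow> ('n \<Rightarrow> nat) \<Rightarrow> real" where
  "monom_at x \<alpha> = (\<Prod>i\<in>UNIV. (x $ i) ^ \<alpha> i)"

(* The family (f_n), n in J, generates: every invariant p is q(f) for a polynomial q in the
   variables with index in J. Variables outside J are eliminated by setting them to 0. *)
definition generates_invariants ::
  "(real ^ 'm ^ 'm) set \<Rightarrow> (real ^ 'm \<Rightarrow> real ^ 'n) \<Rightarrow> 'n set \<Rightarrow> bool" where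
  "generates_invariants G f J \<longleftrightarrow>
     (\<forall>p\<in>real_invariant_polys G. \<exists>q. real_polynomial_function q \<and>
        p = (\<lambda>v. q (\<chi> n. if n \<in> J then f v $ n else 0)))"

definition minimal_generators ::
  "(real ^ 'm ^ 'm) set \<Rightarrow> (real ^ 'm \<Rightarrow> real ^ 'n) \<Rightarrow> bool" where
  "minimal_generators G f \<longleftrightarrow>
     (\<forall>n. (\<lambda>v. f v $ n) \<in> real_invariant_polys G) \<and>
     generates_invariants G f UNIV \<and>
     (\<forall>J. J \<subset> UNIV \<longrightarrow> \<not> generates_invariants G f J)"

definition invariant_moment_measures :: "(real ^ 'm ^ 'm) set \<Rightarrow> (real ^ 'm) measure set" where
  "invariant_moment_measures G =
     {P. sets P = sets borel \<and> invariant_measure G P \<and>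
         (\<forall>\<alpha>. integrable P (\<lambda>x. monom_at x \<alpha>))}"

definition invariant_moment ::
  "(real ^ 'm \<Rightarrow> real ^ 'n) \<Rightarrow> (real ^ 'm) measure \<Rightarrow> ('n \<Rightarrow> nat) \<Rightarrow> real" where
  "invariant_moment f P \<alpha> = (LINT v|P. monom_at (f v) \<alpha>)"

definition G_determinate ::
  "(real ^ 'm ^ 'm) set \<Rightarrow> (real ^ 'm \<Rightarrow> real ^ 'n) \<Rightarrow> (real ^ 'm) measure \<Rightarrow> bool" where
  "G_determinate G f P \<longleftrightarrow>
     P \<in> invariant_moment_measures G \<and>
     (\<forall>Q\<in>invariant_moment_measures G.
        (\<forall>\<alpha>. invariant_moment f Q \<alpha> = invariant_moment f P \<alpha>) \<longrightarrow> Q = P)"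

(* In ennreal, 1 / 0 is infinity, as required for a vanishing even moment. *)
definition carleman :: "(nat \<Rightarrow> real) \<Rightarrow> bool" where
  "carleman s \<longleftrightarrow>
     (\<Sum>j. 1 / ennreal (s (2 * Suc j) powr (1 / real (2 * Suc j)))) = \<infinity>"

(* Functions representing the elements of the Lebesgue space; invariance of an equivalence
   class modulo null sets is invariance almost everywhere of a representative. *)
definition Lp_invariant ::
  "(real ^ 'm ^ 'm) set \<Rightarrow> real \<Rightarrow> (real ^ 'm) measure \<Rightarrow> (real ^ 'm \<Rightarrow> complex) set" where
  "Lp_invariant G p P =
     {h. h \<in> borel_measurable P \<and> integrable P (\<lambda>v. norm (h v) powr p) \<and>
         (\<forall>g\<in>G. AE v in P. h (matrix_inv g *v v) = h v)}"

definition Lp_norm :: "real \<Rightarrow> (real ^ 'm) measure \<Rightarrow> (real ^ 'm \<Rightarrow> complex) \<Rightarrow> real" where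
  "Lp_norm p P h = (LINT v|P. norm (h v) powr p) powr (1 / p)"

definition dense_in_Lp_invariant ::
  "(real ^ 'm ^ 'm) set \<Rightarrow> real \<Rightarrow> (real ^ 'm) measure \<Rightarrow> (real ^ 'm \<Rightarrow> complex) set \<Rightarrow> bool" where
  "dense_in_Lp_invariant G p P D \<longleftrightarrow>
     D \<subseteq> Lp_invariant G p P \<and>
     (\<forall>h\<in>Lp_invariant G p P. \<forall>\<epsilon>>0. \<exists>q\<in>D. Lp_norm p P (\<lambda>v. h v - q v) < \<epsilon>)"

definition exp_span ::
  "(real ^ 'm \<Rightarrow> real ^ 'n) \<Rightarrow> (real ^ 'n) set \<Rightarrow> (real ^ 'm \<Rightarrow> complex) set" where
  "exp_span f S =
     {(\<lambda>v. \<Sum>l\<in>T. c l * exp (\<i> * complex_of_real (l \<bullet> f v))) | T c. finite T \<and> T \<subseteq> S}"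

definition somewhere_dense :: "(real ^ 'n) set \<Rightarrow> bool" where
  "somewhere_dense S \<longleftrightarrow> interior (closure S) \<noteq> {}"

end

theory Submission
  imports Defs "HOL-Probability.Characteristic_Functions"
begin

text \<open>
  Let \<open>V\<close> be a closed subspace of \<open>L\<^sub>p(P)\<close> that contains \<open>f\<^sup>\<alpha> exp (i \<langle>\<lambda>, f\<rangle>)\<close> for one \<open>\<lambda>\<close> and all \<open>\<alpha>\<close>.
  Changing \<open>\<lambda>\<close> in one coordinate, with \<open>g\<close> the remaining factor, the distances from
  \<open>f\<^sub>n\<^sup>k exp (i t f\<^sub>n) g\<close> to \<open>V\<close> vanish at \<open>t = 0\<close> for all \<open>k\<close> and satisfy Taylor estimates in \<open>t\<close>. Bang's proof
  of the Denjoy-Carleman theorem applies to these distances directly, without duality, and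
  Carleman's condition makes them vanish for all \<open>t\<close>. So \<open>V\<close> contains all exponentials, hence the
  indicators of all sets \<open>f\<^sup>-\<^sup>1(C)\<close>. As \<open>f\<close> separates orbits, these include the compact invariant
  sets, and by inner regularity \<open>V\<close> contains every invariant function in \<open>L\<^sub>p(P)\<close>.

  Density follows by taking for \<open>V\<close> the closure of the polynomials, or of the exponentials with
  frequency in \<open>S\<close>, where difference quotients in the interior of the closure of \<open>S\<close> supply the
  factors \<open>f\<^sup>\<alpha>\<close>. Determinacy follows by taking for \<open>V\<close> the functions in \<open>L\<^sub>1(P + Q)\<close> with the same
  integral with respect to \<open>P\<close> and \<open>Q\<close>.
\<close>

section \<open>The spaces \<open>L\<^sub>p\<close> and their closed subspaces\<close>

text \<open>Carleman's condition speaks of one coordinate of \<open>f\<close> at a time, whereas the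
  functions to be reached involve all of them. So one coordinate is treated at a time, and
  everything else is put into a weight \<open>g\<close>, of which only integrability of a higher
  power is known. Separating \<open>g\<close> from the powers of the coordinate by the inequality of
  Cauchy-Schwarz type doubles the exponents. Hence the distances in L_p are controlled by the norms
  of the powers in L_(2r), with an integer \<open>r\<close> that is at least \<open>p\<close>, that
  is, by roots of the moments of order 2rn. Two facts make this loss harmless: these norms are again
  log-convex in n, and the roots of the even moments increase up to a constant factor, so that
  keeping every r-th of them preserves divergence.

  In the passage to indicators the obstacles are that \<open>V\<close> is not closed under products,
  that \<open>f\<close> is unbounded, and that the image under \<open>f\<close> of an invariant
  Borel set need not be Borel. They are met by bounded multipliers, by sines in place of
  coordinates, and by compact sets, whose images are compact.\<close>

definition lspace :: "real \<Rightarrow> 'a measure \<Rightarrow> ('a \<Rightarrow> complex) set" where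
  "lspace p M = {h \<in> borel_measurable M. integrable M (\<lambda>v. norm (h v) powr p)}"

definition lnorm :: "real \<Rightarrow> 'a measure \<Rightarrow> ('a \<Rightarrow> complex) \<Rightarrow> real" where
  "lnorm p M h = (LINT v|M. norm (h v) powr p) powr (1 / p)"

lemma lspace_measurable [measurable_dest]: "h \<in> lspace p M \<Longrightarrow> h \<in> borel_measurable M"
  by (simp add: lspace_def)

lemma lnorm_nonneg: "0 \<le> lnorm p M h"
  by (simp add: lnorm_def)

lemma powr_inverse_powr:
  fixes p c :: real
  assumes "p > 0" "c \<ge> 0"
  shows "(c powr p) powr (1 / p) = c"
  using assms by (simp add: powr_powr)

lemma lnorm_powr: "p > 0 \<Longrightarrow> lnorm p M h powr p = (LINT v|M. norm (h v) powr p)"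
  by (simp add: lnorm_def powr_powr)

lemma lnorm_le:
  assumes "p > 0" "c \<ge> 0" "(LINT v|M. norm (h v) powr p) \<le> c powr p"
  shows "lnorm p M h \<le> c"
proof -
  have "lnorm p M h \<le> (c powr p) powr (1 / p)"
    unfolding lnorm_def using assms by (intro powr_mono2) auto
  then show ?thesis using powr_inverse_powr[of p c] assms by simp
qed

lemma lspace_dominated:
  assumes "p > 0" "k \<in> lspace p M" "h \<in> borel_measurable M"
    and le: "AE v in M. norm (h v) \<le> norm (k v)"
  shows "h \<in> lspace p M" "lnorm p M h \<le> lnorm p M k"
proof -
  have *: "AE v in M. norm (h v) powr p \<le> norm (k v) powr p"
    using le by eventually_elim (use assms(1) in \<open>auto intro: powr_mono2\<close>)
  have k: "integrable M (\<lambda>v. norm (k v) powr p)" using assms(2) by (simp add: lspace_def)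
  then have h: "integrable M (\<lambda>v. norm (h v) powr p)"
    by (rule Bochner_Integration.integrable_bound) (use * assms(3) in auto)
  then show "h \<in> lspace p M" using assms(3) by (simp add: lspace_def)
  show "lnorm p M h \<le> lnorm p M k"
    using integral_mono_AE[OF h k *] assms(1) lnorm_nonneg[of p M k]
    by (intro lnorm_le) (auto simp: lnorm_powr)
qed

lemma lspace_bounded:
  assumes "finite_measure M" "p > 0" "h \<in> borel_measurable M" "\<And>v. norm (h v) \<le> K"
  shows "h \<in> lspace p M"
proof -
  interpret finite_measure M by fact
  have "integrable M (\<lambda>v. norm (h v) powr p)"
    by (rule integrable_const_bound[of _ "K powr p"]) (use assms in \<open>auto intro!: powr_mono2\<close>)
  then show ?thesis using assms by (simp add: lspace_def)
qed

lemma lspace_cmult: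
  assumes "p > 0" "h \<in> lspace p M"
  shows "(\<lambda>v. c * h v) \<in> lspace p M" "lnorm p M (\<lambda>v. c * h v) = norm c * lnorm p M h"
proof -
  show "(\<lambda>v. c * h v) \<in> lspace p M"
    using assms(2) by (auto simp: lspace_def norm_mult powr_mult)
  show "lnorm p M (\<lambda>v. c * h v) = norm c * lnorm p M h"
    using powr_inverse_powr[of p "norm c"] assms(1) by (simp add: lnorm_def norm_mult powr_mult)
qed

text \<open>Jensen's inequality for the weights \<open>a / (a + b)\<close> and
  \<open>b / (a + b)\<close> at the points \<open>x / a\<close> and \<open>y / b\<close>. With
  bounds for two norms in place of \<open>a\<close> and \<open>b\<close>, integration turns it into
  Minkowski's inequality.\<close>

lemma convex_combination_powr_le:
  fixes p a b x y :: real
  assumes "p \<ge> 1" "a > 0" "b > 0" "x \<ge> 0" "y \<ge> 0"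
  shows "(x + y) powr p \<le> (a + b) powr p * (a / (a + b) * (x / a) powr p + b / (a + b) * (y / b) powr p)"
proof -
  have conv: "convex_on {0..} (\<lambda>x::real. x powr p)"
  proof (rule convex_onI)
    fix t x y :: real
    assume "0 < t" "t < 1" "x \<in> {0..}" "y \<in> {0..}"
    \<comment> \<open>When one argument is 0, the claim shrinks to the fact that a weight between 0
      and 1 does not grow under the power \<open>p \<ge> 1\<close>.\<close>
    consider "x > 0" "y > 0" | "x = 0" | "y = 0" using \<open>x \<in> {0..}\<close> \<open>y \<in> {0..}\<close> by fastforce
    then show "((1 - t) *\<^sub>R x + t *\<^sub>R y) powr p \<le> (1 - t) * x powr p + t * y powr p"
    proof cases
      case 1
      then show ?thesis
        using convex_onD[OF powr_convex[OF assms(1)], of t x y] \<open>0 < t\<close> \<open>t < 1\<close> by simp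
    next
      case 2
      have "t powr p \<le> t powr 1" using \<open>0 < t\<close> \<open>t < 1\<close> assms(1) by (intro powr_mono') auto
      then show ?thesis using 2 \<open>0 < t\<close> by (simp add: powr_mult mult_right_mono)
    next
      case 3
      have "(1 - t) powr p \<le> (1 - t) powr 1" using \<open>0 < t\<close> \<open>t < 1\<close> assms(1) by (intro powr_mono') auto
      then show ?thesis using 3 \<open>t < 1\<close> by (simp add: powr_mult mult_right_mono)
    qed
  qed (rule convex_real_interval)
  define t where "t = b / (a + b)"
  have t: "0 \<le> t" "t \<le> 1" "1 - t = a / (a + b)" using assms by (auto simp: t_def field_simps)
  have "x + y = (a + b) * ((1 - t) *\<^sub>R (x / a) + t *\<^sub>R (y / b))"
  proof -
    have "(a + b) * ((1 - t) *\<^sub>R (x / a) + t *\<^sub>R (y / b)) = (a + b) * (x / (a + b) + y / (a + b))"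
      using assms unfolding t(3) by (simp add: t_def)
    also have "\<dots> = x + y" using assms by (simp add: add_divide_distrib[symmetric])
    finally show ?thesis ..
  qed
  then have "(x + y) powr p = (a + b) powr p * ((1 - t) *\<^sub>R (x / a) + t *\<^sub>R (y / b)) powr p"
    by (metis powr_mult)
  also have "\<dots> \<le> (a + b) powr p * ((1 - t) * (x / a) powr p + t * (y / b) powr p)"
    using convex_onD[OF conv t(1,2), of "x / a" "y / b"] assms by (intro mult_left_mono) auto
  finally show ?thesis unfolding t(3) by (simp add: t_def)
qed

text \<open>Minkowski's inequality with positive bounds \<open>a\<close>, \<open>b\<close> instead
  of the norms: the normalisation divides by them, and a norm may be 0. In
  \<open>lnorm_triangle\<close> the bounds shrink to the norms.\<close>

lemma lspace_add_lnorm_le: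
  assumes p: "p \<ge> 1" and h: "h \<in> lspace p M" and k: "k \<in> lspace p M"
    and a: "a > 0" "lnorm p M h \<le> a" and b: "b > 0" "lnorm p M k \<le> b"
  shows "(\<lambda>v. h v + k v) \<in> lspace p M" "lnorm p M (\<lambda>v. h v + k v) \<le> a + b"
proof -
  define w where "w = (\<lambda>v. (a + b) powr p *
    (a / (a + b) * (norm (h v) / a) powr p + b / (a + b) * (norm (k v) / b) powr p))"
  have ih: "integrable M (\<lambda>v. norm (h v) powr p)" and ik: "integrable M (\<lambda>v. norm (k v) powr p)"
    using h k by (auto simp: lspace_def)
  have iw: "integrable M w"
    using ih ik a b unfolding w_def by (simp add: powr_divide)
  have le: "norm (h v + k v) powr p \<le> w v" for v
  proof -
    have "norm (h v + k v) powr p \<le> (norm (h v) + norm (k v)) powr p"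
      using p by (intro powr_mono2) (auto intro: norm_triangle_ineq)
    also have "\<dots> \<le> w v" unfolding w_def using p a b by (intro convex_combination_powr_le) auto
    finally show ?thesis .
  qed
  have [measurable]: "h \<in> borel_measurable M" "k \<in> borel_measurable M" using h k by (auto simp: lspace_def)
  have ihk: "integrable M (\<lambda>v. norm (h v + k v) powr p)"
    by (rule Bochner_Integration.integrable_bound[OF iw]) (use le in \<open>auto intro: order_trans[OF _ abs_ge_self]\<close>)
  then show "(\<lambda>v. h v + k v) \<in> lspace p M" by (simp add: lspace_def)
  have one: "(LINT v|M. (norm (u v) / c) powr p) \<le> 1" if "c > 0" "lnorm p M u \<le> c" for u c
  proof -
    have "(LINT v|M. (norm (u v) / c) powr p) = lnorm p M u powr p / c powr p"
      using p that by (simp add: powr_divide lnorm_powr)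
    also have "\<dots> \<le> 1" using p that lnorm_nonneg[of p M u] by (simp add: powr_mono2)
    finally show ?thesis .
  qed
  have "(LINT v|M. norm (h v + k v) powr p) \<le> (LINT v|M. w v)"
    using ihk iw le by (intro integral_mono)
  also have "\<dots> = (a + b) powr p * (a / (a + b) * (LINT v|M. (norm (h v) / a) powr p)
      + b / (a + b) * (LINT v|M. (norm (k v) / b) powr p))"
    unfolding w_def using ih ik a b by (simp add: powr_divide)
  also have "\<dots> \<le> (a + b) powr p * (a / (a + b) * 1 + b / (a + b) * 1)"
    using a b by (intro mult_left_mono add_mono one) auto
  also have "\<dots> = (a + b) powr p" using a b by (simp add: add_divide_distrib[symmetric])
  finally show "lnorm p M (\<lambda>v. h v + k v) \<le> a + b"
    using p a b by (intro lnorm_le) auto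
qed

lemma lspace_add:
  assumes "p \<ge> 1" "h \<in> lspace p M" "k \<in> lspace p M"
  shows "(\<lambda>v. h v + k v) \<in> lspace p M"
  using lspace_add_lnorm_le(1)[OF assms, of "lnorm p M h + 1" "lnorm p M k + 1"]
    lnorm_nonneg[of p M h] lnorm_nonneg[of p M k]
  by auto

lemma lnorm_triangle:
  assumes "p \<ge> 1" "h \<in> lspace p M" "k \<in> lspace p M"
  shows "lnorm p M (\<lambda>v. h v + k v) \<le> lnorm p M h + lnorm p M k"
proof (rule field_le_epsilon)
  fix e :: real
  assume "e > 0"
  then show "lnorm p M (\<lambda>v. h v + k v) \<le> lnorm p M h + lnorm p M k + e"
    using lspace_add_lnorm_le(2)[OF assms, of "lnorm p M h + e / 2" "lnorm p M k + e / 2"]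
      lnorm_nonneg[of p M h] lnorm_nonneg[of p M k] by auto
qed

lemma lspace_zero: "(\<lambda>v. 0) \<in> lspace p M"
  by (simp add: lspace_def)

lemma lspace_diff:
  assumes "p \<ge> 1" "h \<in> lspace p M" "k \<in> lspace p M"
  shows "(\<lambda>v. h v - k v) \<in> lspace p M"
  using lspace_add[OF assms(1,2) lspace_cmult(1)[of p k M "-1"]] assms by simp

lemma lspace_sum:
  assumes "p \<ge> 1" "\<And>i. i \<in> I \<Longrightarrow> h i \<in> lspace p M"
  shows "(\<lambda>v. \<Sum>i\<in>I. h i v) \<in> lspace p M"
  using assms(2) by (induction I rule: infinite_finite_induct) (auto simp: lspace_zero lspace_add assms(1))

lemma lnorm_tendsto_zero:
  assumes "p \<ge> 1" and w: "w \<in> lspace p M"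
    and h: "\<And>i. h i \<in> borel_measurable M" "k \<in> borel_measurable M"
    and lim: "AE v in M. (\<lambda>i. h i v) \<longlonglongrightarrow> k v"
    and le: "\<And>i. AE v in M. norm (k v - h i v) \<le> norm (w v)"
  shows "(\<lambda>i. lnorm p M (\<lambda>v. k v - h i v)) \<longlonglongrightarrow> 0"
proof -
  have "(\<lambda>i. LINT v|M. norm (k v - h i v) powr p) \<longlonglongrightarrow> (LINT v|M. 0)"
  proof (rule integral_dominated_convergence[where w = "\<lambda>v. norm (w v) powr p"])
    show "integrable M (\<lambda>v. norm (w v) powr p)" using w by (simp add: lspace_def)
    show "AE v in M. norm (norm (k v - h i v) powr p) \<le> norm (w v) powr p" for i
      using le[of i] by eventually_elim (use assms(1) in \<open>auto intro: powr_mono2\<close>)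
    show "AE v in M. (\<lambda>i. norm (k v - h i v) powr p) \<longlonglongrightarrow> 0"
      using lim
    proof eventually_elim
      case (elim v)
      have "(\<lambda>i. norm (k v - h i v)) \<longlonglongrightarrow> 0"
        using tendsto_norm[OF tendsto_diff[OF tendsto_const elim, of "k v"]] by simp
      then show ?case
        using tendsto_powr2[of "\<lambda>i. norm (k v - h i v)" 0 sequentially "\<lambda>_. p" p] assms(1) by simp
    qed
  qed (use h in auto)
  then show ?thesis
    unfolding lnorm_def
    using tendsto_powr2[of "\<lambda>i. LINT v|M. norm (k v - h i v) powr p" 0 sequentially "\<lambda>_. 1 / p" "1 / p"] assms(1)
    by simp
qed

text \<open>Elements are functions, not classes modulo null sets. Stability under changes on null
  sets is contained in the last clause, because functions that agree almost everywhere are at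
  distance 0.\<close>

definition closed_subspace :: "real \<Rightarrow> 'a measure \<Rightarrow> ('a \<Rightarrow> complex) set \<Rightarrow> bool" where
  "closed_subspace p M V \<longleftrightarrow> V \<subseteq> lspace p M \<and> (\<lambda>v. 0) \<in> V \<and>
     (\<forall>h\<in>V. \<forall>k\<in>V. (\<lambda>v. h v + k v) \<in> V) \<and> (\<forall>c. \<forall>h\<in>V. (\<lambda>v. c * h v) \<in> V) \<and>
     (\<forall>h\<in>lspace p M. (\<forall>\<epsilon>>0. \<exists>q\<in>V. lnorm p M (\<lambda>v. h v - q v) < \<epsilon>) \<longrightarrow> h \<in> V)"

lemma
  assumes "closed_subspace p M V"
  shows closed_subspace_lspace: "h \<in> V \<Longrightarrow> h \<in> lspace p M"
    and closed_subspace_zero: "(\<lambda>v. 0) \<in> V"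
    and closed_subspace_add: "h \<in> V \<Longrightarrow> k \<in> V \<Longrightarrow> (\<lambda>v. h v + k v) \<in> V"
    and closed_subspace_cmult: "h \<in> V \<Longrightarrow> (\<lambda>v. c * h v) \<in> V"
    and closed_subspace_closed:
      "h \<in> lspace p M \<Longrightarrow> (\<And>\<epsilon>. \<epsilon> > 0 \<Longrightarrow> \<exists>q\<in>V. lnorm p M (\<lambda>v. h v - q v) < \<epsilon>) \<Longrightarrow> h \<in> V"
  using assms unfolding closed_subspace_def by blast+

lemma closed_subspace_diff:
  assumes "closed_subspace p M V" "h \<in> V" "k \<in> V"
  shows "(\<lambda>v. h v - k v) \<in> V"
  using closed_subspace_add[OF assms(1,2) closed_subspace_cmult[OF assms(1,3), of "-1"]] by simp

lemma closed_subspace_sum: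
  assumes "closed_subspace p M V" "\<And>i. i \<in> I \<Longrightarrow> h i \<in> V"
  shows "(\<lambda>v. \<Sum>i\<in>I. h i v) \<in> V"
  using assms(2)
  by (induction I rule: infinite_finite_induct)
    (auto simp: closed_subspace_zero[OF assms(1)] closed_subspace_add[OF assms(1)])

lemma closed_subspace_limit:
  assumes "closed_subspace p M V" "h \<in> lspace p M" "\<And>i. q i \<in> V"
    and "(\<lambda>i. lnorm p M (\<lambda>v. h v - q i v)) \<longlonglongrightarrow> 0"
  shows "h \<in> V"
proof (rule closed_subspace_closed[OF assms(1,2)])
  fix \<epsilon> :: real assume "\<epsilon> > 0"
  then show "\<exists>q\<in>V. lnorm p M (\<lambda>v. h v - q v) < \<epsilon>"
    using order_tendstoD(2)[OF assms(4), of \<epsilon>] assms(3) by (auto simp: eventually_sequentially)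
qed

text \<open>The usual way of entering \<open>V\<close> below. The bound by \<open>w\<close>, and
  with it membership in \<open>lspace p M\<close>, passes from the sequence to its limit, so only
  measurability of \<open>k\<close> has to be supplied.\<close>

lemma closed_subspace_dominated_limit:
  assumes "p \<ge> 1" and V: "closed_subspace p M V" and w: "w \<in> lspace p M"
    and h: "\<And>i. h i \<in> V" and k: "k \<in> borel_measurable M"
    and lim: "AE v in M. (\<lambda>i. h i v) \<longlonglongrightarrow> k v"
    and le: "\<And>i. AE v in M. norm (h i v) \<le> norm (w v)"
  shows "k \<in> V"
proof -
  have hm: "h i \<in> borel_measurable M" for i using closed_subspace_lspace[OF V h] by measurable
  have "AE v in M. \<forall>i. norm (h i v) \<le> norm (w v)" using le by (simp add: AE_all_countable)
  then have kw: "AE v in M. norm (k v) \<le> norm (w v)"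
    using lim
  proof eventually_elim
    case (elim v)
    show ?case by (rule tendsto_upperbound[OF tendsto_norm[OF elim(2)]]) (use elim(1) in auto)
  qed
  have k': "k \<in> lspace p M" using assms by (intro lspace_dominated(1)[OF _ w k kw]) auto
  show ?thesis
  proof (rule closed_subspace_limit[OF V k' h lnorm_tendsto_zero[OF assms(1) _ hm k lim]])
    show "(\<lambda>v. 2 * w v) \<in> lspace p M" using assms by (intro lspace_cmult) auto
    show "AE v in M. norm (k v - h i v) \<le> norm (2 * w v)" for i
      using kw le[of i]
    proof eventually_elim
      case (elim v)
      then show ?case using norm_triangle_ineq4[of "k v" "h i v"] by (simp add: norm_mult)
    qed
  qed
qed

lemma closed_subspace_AE_cong:
  assumes "p \<ge> 1" "closed_subspace p M V" "g \<in> V" "h \<in> borel_measurable M" "AE v in M. h v = g v"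
  shows "h \<in> V"
proof (rule closed_subspace_dominated_limit[OF assms(1,2) closed_subspace_lspace[OF assms(2,3)], of "\<lambda>_. g"])
  show "AE v in M. (\<lambda>i. g v) \<longlonglongrightarrow> h v" using assms(5) by eventually_elim auto
qed (use assms in auto)

definition lclosure :: "real \<Rightarrow> 'a measure \<Rightarrow> ('a \<Rightarrow> complex) set \<Rightarrow> ('a \<Rightarrow> complex) set" where
  "lclosure p M D = {h \<in> lspace p M. \<forall>\<epsilon>>0. \<exists>q\<in>D. lnorm p M (\<lambda>v. h v - q v) < \<epsilon>}"

lemma lclosure_superset:
  assumes "D \<subseteq> lspace p M"
  shows "D \<subseteq> lclosure p M D"
proof
  fix h assume "h \<in> D"
  moreover have "lnorm p M (\<lambda>v. h v - h v) = 0" by (simp add: lnorm_def)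
  ultimately show "h \<in> lclosure p M D"
    using assms unfolding lclosure_def by (auto intro!: bexI[of _ h])
qed

lemma closed_subspace_lclosure:
  assumes p: "p \<ge> 1" and D: "D \<subseteq> lspace p M" "(\<lambda>v. 0) \<in> D"
    "\<And>h k. h \<in> D \<Longrightarrow> k \<in> D \<Longrightarrow> (\<lambda>v. h v + k v) \<in> D" "\<And>c h. h \<in> D \<Longrightarrow> (\<lambda>v. c * h v) \<in> D"
  shows "closed_subspace p M (lclosure p M D)"
  unfolding closed_subspace_def
proof (intro conjI ballI allI impI)
  show "lclosure p M D \<subseteq> lspace p M" by (auto simp: lclosure_def)
  show "(\<lambda>v. 0) \<in> lclosure p M D" using lclosure_superset[OF D(1)] D(2) by auto
next
  fix h k assume h: "h \<in> lclosure p M D" and k: "k \<in> lclosure p M D"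
  have "\<exists>q\<in>D. lnorm p M (\<lambda>v. h v + k v - q v) < \<epsilon>" if "\<epsilon> > 0" for \<epsilon>
  proof -
    have "\<epsilon> / 2 > 0" using that by simp
    then obtain q r where q: "q \<in> D" "lnorm p M (\<lambda>v. h v - q v) < \<epsilon> / 2"
      and r: "r \<in> D" "lnorm p M (\<lambda>v. k v - r v) < \<epsilon> / 2"
      using h k unfolding lclosure_def by blast
    have "lnorm p M (\<lambda>v. (h v - q v) + (k v - r v)) \<le> lnorm p M (\<lambda>v. h v - q v) + lnorm p M (\<lambda>v. k v - r v)"
      using h k q r D(1) p by (intro lnorm_triangle lspace_diff) (auto simp: lclosure_def)
    then have "lnorm p M (\<lambda>v. h v + k v - (q v + r v)) < \<epsilon>"
      using q(2) r(2) by (simp add: algebra_simps)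
    then show ?thesis using D(3)[OF q(1) r(1)] by (intro bexI[of _ "\<lambda>v. q v + r v"])
  qed
  then show "(\<lambda>v. h v + k v) \<in> lclosure p M D"
    using h k p by (auto simp: lclosure_def lspace_add)
next
  fix c h assume h: "h \<in> lclosure p M D"
  have "\<exists>q\<in>D. lnorm p M (\<lambda>v. c * h v - q v) < \<epsilon>" if "\<epsilon> > 0" for \<epsilon>
  proof -
    \<comment> \<open>Adding 1 keeps the divisor positive when \<open>c = 0\<close>.\<close>
    have "0 < \<epsilon> / (norm c + 1)" using that by (simp add: add_nonneg_pos)
    then obtain q where q: "q \<in> D" "lnorm p M (\<lambda>v. h v - q v) < \<epsilon> / (norm c + 1)"
      using h unfolding lclosure_def by blast
    have "lnorm p M (\<lambda>v. c * (h v - q v)) = norm c * lnorm p M (\<lambda>v. h v - q v)"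
      using h q D(1) p by (intro lspace_cmult lspace_diff) (auto simp: lclosure_def)
    also have "\<dots> \<le> (norm c + 1) * lnorm p M (\<lambda>v. h v - q v)"
      using lnorm_nonneg by (intro mult_right_mono) auto
    also have "\<dots> < \<epsilon>" using q(2) by (subst (asm) pos_less_divide_eq) (simp_all add: add_nonneg_pos mult.commute)
    finally have "lnorm p M (\<lambda>v. c * h v - c * q v) < \<epsilon>" by (simp add: right_diff_distrib)
    then show ?thesis using D(4)[OF q(1)] by (intro bexI[of _ "\<lambda>v. c * q v"])
  qed
  then show "(\<lambda>v. c * h v) \<in> lclosure p M D"
    using h p by (auto simp: lclosure_def lspace_cmult)
next
  fix h assume h: "h \<in> lspace p M" and *: "\<forall>\<epsilon>>0. \<exists>q\<in>lclosure p M D. lnorm p M (\<lambda>v. h v - q v) < \<epsilon>"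
  have "\<exists>q\<in>D. lnorm p M (\<lambda>v. h v - q v) < \<epsilon>" if "\<epsilon> > 0" for \<epsilon>
  proof -
    have half: "\<epsilon> / 2 > 0" using that by simp
    then obtain q where q: "q \<in> lclosure p M D" "lnorm p M (\<lambda>v. h v - q v) < \<epsilon> / 2"
      using * by blast
    then obtain r where r: "r \<in> D" "lnorm p M (\<lambda>v. q v - r v) < \<epsilon> / 2"
      using half unfolding lclosure_def by blast
    have "lnorm p M (\<lambda>v. (h v - q v) + (q v - r v)) \<le> lnorm p M (\<lambda>v. h v - q v) + lnorm p M (\<lambda>v. q v - r v)"
      using h q r D(1) p by (intro lnorm_triangle lspace_diff) (auto simp: lclosure_def)
    then have "lnorm p M (\<lambda>v. h v - r v) < \<epsilon>" using q(2) r(2) by simp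
    then show ?thesis using r(1) by blast
  qed
  then show "h \<in> lclosure p M D" using h by (simp add: lclosure_def)
qed

section \<open>Bang's vanishing criterion\<close>

text \<open>Log-convexity makes the ratios \<open>M (Suc i) / M i\<close> increase with
  \<open>i\<close>. The \<open>k\<close> ratios leading from \<open>M n\<close> to
  \<open>M (n + k)\<close> have indices at most \<open>L\<close>, so each is bounded by the one at
  \<open>L\<close>.\<close>

lemma log_convex_shift:
  fixes M :: "nat \<Rightarrow> real"
  assumes pos: "\<And>n. M n > 0"
    and conv: "\<And>n. M (Suc n) ^ 2 \<le> M n * M (Suc (Suc n))"
  shows "n + k \<le> Suc L \<Longrightarrow> M (n + k) \<le> M n * (M (Suc L) / M L) ^ k"
proof (induction k)
  case (Suc k)
  have mono: "incseq (\<lambda>i. M (Suc i) / M i)"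
    using conv pos by (intro incseq_SucI) (simp add: field_simps power2_eq_square)
  have "M (n + Suc k) = M (n + k) * (M (Suc (n + k)) / M (n + k))"
    using pos[of "n + k"] by simp
  also have "\<dots> \<le> (M n * (M (Suc L) / M L) ^ k) * (M (Suc L) / M L)"
    using Suc pos incseqD[OF mono, of "n + k" L]
    by (intro mult_mono) (auto intro!: mult_nonneg_nonneg less_imp_le)
  finally show ?case by (simp add: mult_ac)
qed simp

text \<open>
  Bang's argument: the quantity \<open>sup n. A n t / (exp n * M n)\<close> needs a time of at least
  \<open>M (N - 1) / (exp 1 * M N)\<close> to grow from \<open>exp (- N)\<close> to \<open>exp (- (N - 1))\<close>.
\<close>

lemma bang_step:
  fixes A :: "nat \<Rightarrow> real \<Rightarrow> real" and M :: "nat \<Rightarrow> real"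
  assumes pos: "\<And>n. M n > 0"
    and conv: "\<And>n. M (Suc n) ^ 2 \<le> M n * M (Suc (Suc n))"
    and le: "\<And>n t. A n t \<le> M n"
    and taylor: "\<And>n m t h. h \<ge> 0 \<Longrightarrow>
      A n (t + h) \<le> (\<Sum>k<m. h ^ k / fact k * A (n + k) t) + h ^ m / fact m * M (n + m)"
    and small: "\<And>n. A n t \<le> exp (real n - real (Suc L)) * M n"
    and h: "0 \<le> h" "h \<le> exp (-1) * (M L / M (Suc L))"
  shows "A n (t + h) \<le> exp (real n - real L) * M n"
proof (cases "n \<le> L")
  \<comment> \<open>For \<open>n > L\<close> the exponential factor is at least 1, and the a priori
    bound is enough.\<close>
  case False
  have "A n (t + h) \<le> 1 * M n" using le by simp
  also have "\<dots> \<le> exp (real n - real L) * M n"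
    using False less_imp_le[OF pos] by (intro mult_right_mono) auto
  finally show ?thesis .
next
  case True
  \<comment> \<open>The Taylor expansion is made to end at index \<open>Suc L\<close>, where the
    exponential factor in \<open>small\<close> equals 1. The remainder, which involves only
    \<open>M (n + m)\<close>, then has the same shape as the other terms.\<close>
  define m where "m = Suc L - n"
  define \<tau> where "\<tau> = M (Suc L) / M L"
  define c where "c = exp (real n - real (Suc L))"
  have nm: "n + m = Suc L" using True by (simp add: m_def)
  have \<tau>: "\<tau> > 0" using pos by (simp add: \<tau>_def)
  \<comment> \<open>The Taylor sum is compared below with the exponential series at this point. So
    one step costs at most a factor \<open>exp 1\<close>, the gap between level \<open>Suc L\<close>
    and level \<open>L\<close>.\<close>
  have h\<tau>: "exp 1 * h * \<tau> \<le> 1"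
  proof -
    have "exp 1 * h * \<tau> \<le> exp 1 * (exp (-1) * (M L / M (Suc L))) * \<tau>"
      using h \<tau> by (intro mult_right_mono mult_left_mono) auto
    also have "\<dots> = 1" using pos[of L] pos[of "Suc L"] by (simp add: \<tau>_def exp_minus)
    finally show ?thesis .
  qed
  have ineq: "h ^ k / fact k * (exp (real k) * M (n + k)) \<le> M n * ((exp 1 * h * \<tau>) ^ k / fact k)"
    if "k \<le> m" for k
  proof -
    have "M (n + k) \<le> M n * \<tau> ^ k"
      unfolding \<tau>_def using that nm by (intro log_convex_shift pos conv) auto
    then have "h ^ k / fact k * (exp (real k) * M (n + k)) \<le> h ^ k / fact k * (exp (real k) * (M n * \<tau> ^ k))"
      using h by (intro mult_left_mono) auto
    also have "\<dots> = M n * ((exp 1 * h * \<tau>) ^ k / fact k)"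
      by (simp add: power_mult_distrib exp_of_nat_mult[symmetric])
    finally show ?thesis .
  qed
  have "A n (t + h) \<le> (\<Sum>k<m. h ^ k / fact k * A (n + k) t) + h ^ m / fact m * M (n + m)"
    by (rule taylor) (use h in auto)
  also have "\<dots> \<le> (\<Sum>k<m. h ^ k / fact k * (exp (real (n + k) - real (Suc L)) * M (n + k)))
      + h ^ m / fact m * (exp (real (n + m) - real (Suc L)) * M (n + m))"
    using h by (intro add_mono sum_mono mult_left_mono small) (auto simp: nm)
  also have "\<dots> = c * (\<Sum>k\<le>m. h ^ k / fact k * (exp (real k) * M (n + k)))"
    by (simp add: c_def sum_distrib_left lessThan_Suc_atMost[symmetric] exp_add exp_diff algebra_simps)
  also have "\<dots> \<le> c * (\<Sum>k\<le>m. M n * ((exp 1 * h * \<tau>) ^ k / fact k))"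
    by (intro mult_left_mono sum_mono ineq) (auto simp: c_def)
  also have "\<dots> = c * (M n * (\<Sum>k\<le>m. (exp 1 * h * \<tau>) ^ k / fact k))"
    by (simp add: sum_distrib_left)
  also have "\<dots> \<le> c * (M n * exp 1)"
  proof -
    have "(\<Sum>k\<le>m. (exp 1 * h * \<tau>) ^ k / fact k) \<le> exp (exp 1 * h * \<tau>)"
      using h \<tau> summable_exp_generic[of "exp 1 * h * \<tau>"]
      by (subst (2) exp_def) (rule order_trans[OF _ sum_le_suminf[where I = "{..m}"]], auto simp: divide_inverse_commute)
    also have "\<dots> \<le> exp 1" using h\<tau> by simp
    finally show ?thesis using pos[of n] by (intro mult_left_mono) (auto simp: c_def)
  qed
  also have "\<dots> = exp (real n - real L) * M n"
    by (simp add: c_def exp_diff exp_add)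
  finally show ?thesis .
qed

text \<open>A step of length \<open>u K\<close> leads from level \<open>Suc K\<close> to level
  \<open>K\<close>, so descending from \<open>K + d\<close> to \<open>K\<close> covers the sum of
  the \<open>u i\<close> in between. By divergence this sum exceeds \<open>t\<close> for every
  \<open>K\<close> and suitable \<open>d\<close>, and at time 0 every level is available. Hence
  \<open>A n t\<close> lies below \<open>exp (real n - real K) * M n\<close> for all
  \<open>K\<close>.\<close>

lemma bang_vanishing:
  fixes A :: "nat \<Rightarrow> real \<Rightarrow> real" and M :: "nat \<Rightarrow> real"
  assumes pos: "\<And>n. M n > 0"
    and conv: "\<And>n. M (Suc n) ^ 2 \<le> M n * M (Suc (Suc n))"
    and le: "\<And>n t. A n t \<le> M n"
    and taylor: "\<And>n m t h. h \<ge> 0 \<Longrightarrow>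
      A n (t + h) \<le> (\<Sum>k<m. h ^ k / fact k * A (n + k) t) + h ^ m / fact m * M (n + m)"
    and zero: "\<And>n. A n 0 \<le> 0"
    and div: "\<not> summable (\<lambda>n. M n / M (Suc n))"
    and t: "t \<ge> 0"
  shows "A n t \<le> 0"
proof -
  define u where "u = (\<lambda>i. exp (-1) * (M i / M (Suc i)))"
  have u: "u i \<ge> 0" for i using less_imp_le[OF pos] by (auto simp: u_def)
  have short: "A n s \<le> exp (real n - real K) * M n" if "0 \<le> s" "s \<le> (\<Sum>i=K..<K+d. u i)" for n K d s
    using that
  proof (induction d arbitrary: K n s)
    case 0
    then have "s = 0" by simp
    moreover have "0 \<le> exp (real n - real K) * M n" using less_imp_le[OF pos] by auto
    ultimately show ?case using zero[of n] by simp
  next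
    case (Suc d)
    define \<sigma> where "\<sigma> = (\<Sum>i=Suc K..<Suc K + d. u i)"
    have \<sigma>: "\<sigma> \<ge> 0" unfolding \<sigma>_def by (intro sum_nonneg u)
    have sum: "(\<Sum>i=K..<K + Suc d. u i) = u K + \<sigma>"
      by (simp add: \<sigma>_def sum.atLeast_Suc_lessThan)
    \<comment> \<open>At time \<open>s'\<close> level \<open>Suc K\<close> is still guaranteed; what
      remains of \<open>s\<close> is at most \<open>u K\<close>, one admissible step.\<close>
    define s' where "s' = min s \<sigma>"
    have "A n (s' + (s - s')) \<le> exp (real n - real K) * M n"
    proof (rule bang_step[OF pos conv le taylor])
      show "A n s' \<le> exp (real n - real (Suc K)) * M n" for n
        using Suc.prems(1) \<sigma> by (intro Suc.IH) (auto simp: s'_def \<sigma>_def)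
      show "0 \<le> s - s'" by (simp add: s'_def)
      have "s - s' \<le> u K" using Suc.prems(2) u[of K] unfolding sum by (auto simp: s'_def)
      then show "s - s' \<le> exp (-1) * (M K / M (Suc K))" by (simp add: u_def)
    qed auto
    then show ?case by simp
  qed
  have "\<not> summable u"
  proof
    assume "summable u"
    then have "summable (\<lambda>i. exp 1 * u i)" by (rule summable_mult)
    moreover have "exp 1 * u i = M i / M (Suc i)" for i by (simp add: u_def exp_minus)
    ultimately show False using div by simp
  qed
  have bound: "A n t \<le> exp (real n - real K) * M n" for K
  proof -
    have "\<exists>d. t \<le> (\<Sum>i=K..<K+d. u i)"
    proof (rule ccontr)
      assume "\<not> ?thesis"
      then have *: "(\<Sum>i=K..<K+d. u i) \<le> t" for d by (meson linear)
      have "summable (\<lambda>i. u (i + K))"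
      proof (rule summableI_nonneg_bounded)
        fix d
        show "(\<Sum>i<d. u (i + K)) \<le> t"
          using *[of d] sum.shift_bounds_nat_ivl[of u 0 K d] by (simp add: atLeast0LessThan add.commute)
      qed (rule u)
      then show False using \<open>\<not> summable u\<close> by (simp add: summable_iff_shift)
    qed
    then show ?thesis using short[of t K] t by blast
  qed
  have "(\<lambda>K. exp (real n - real K) * M n) \<longlonglongrightarrow> 0"
  proof (intro tendsto_mult_left_zero)
    have "filterlim (\<lambda>K. real n - real K) at_bot sequentially"
      unfolding filterlim_uminus_at_bot
      using filterlim_tendsto_add_at_top[OF tendsto_const filterlim_real_sequentially, of "- real n"]
      by simp
    then show "(\<lambda>K. exp (real n - real K)) \<longlonglongrightarrow> 0"
      by (rule filterlim_compose[OF exp_at_bot])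
  qed
  then show ?thesis
    using bound by (intro tendsto_lowerbound[OF _ _ trivial_limit_sequentially]) auto
qed

section \<open>Carleman's condition\<close>

text \<open>
  AM-GM with the weights \<open>(k + 2) ^ (k + 1) / (k + 1) ^ k\<close>, whose product over \<open>k < n\<close> is \<open>(n + 1) ^ n\<close>.
\<close>

lemma carleman_inequality:
  fixes u :: "nat \<Rightarrow> real"
  assumes nonneg: "\<And>k. u k \<ge> 0"
  shows "(\<Sum>n<m. (\<Prod>k<Suc n. u k) powr (1 / real (Suc n))) \<le> exp 1 * (\<Sum>k<m. u k)"
proof -
  define c where "c = (\<lambda>k. (real k + 2) ^ Suc k / (real k + 1) ^ k)"
  have c: "c k > 0" for k by (simp add: c_def)
  have prod_c: "(\<Prod>k<n. c k) = (real n + 1) ^ n" for n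
    by (induction n) (simp_all add: c_def add.commute)
  have c_le: "c k / real (Suc k) \<le> exp 1" for k
  proof -
    have "c k / real (Suc k) = (1 + 1 / real (Suc k)) ^ Suc k"
    proof -
      have "1 + 1 / real (Suc k) = (real k + 2) / (real k + 1)" by (simp add: field_simps)
      then show ?thesis by (simp add: c_def power_divide add.commute)
    qed
    also have "\<dots> \<le> exp (1 / real (Suc k)) ^ Suc k"
      by (intro power_mono exp_ge_add_one_self) auto
    also have "\<dots> = exp 1"
      by (simp add: exp_of_nat_mult[symmetric] del: of_nat_Suc power_Suc)
    finally show ?thesis .
  qed
  \<comment> \<open>The weights have geometric mean \<open>Suc (Suc n)\<close>. Together with the
    divisor \<open>Suc n\<close> of the arithmetic mean this produces the factor that
    telescopes.\<close>
  have geo: "(\<Prod>k<Suc n. u k) powr (1 / real (Suc n))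
      \<le> (\<Sum>k<Suc n. c k * u k) * (1 / (real (Suc n) * real (Suc (Suc n))))" for n
  proof -
    have "(\<Prod>k<Suc n. c k * u k) powr (1 / real (Suc n)) \<le> (\<Sum>k<Suc n. c k * u k / real (Suc n))"
      using arith_geom_mean[of "{..<Suc n}" "\<lambda>k. c k * u k"] nonneg less_imp_le[OF c]
      by (simp del: sum.lessThan_Suc prod.lessThan_Suc add: lessThan_empty_iff)
    moreover have "(\<Prod>k<Suc n. c k * u k) powr (1 / real (Suc n))
        = ((real (Suc n) + 1) ^ Suc n) powr (1 / real (Suc n)) * (\<Prod>k<Suc n. u k) powr (1 / real (Suc n))"
      unfolding prod.distrib prod_c by (rule powr_mult)
    moreover have "((real (Suc n) + 1) ^ Suc n) powr (1 / real (Suc n)) = real (Suc (Suc n))"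
      by (subst powr_realpow[symmetric]) (simp_all add: powr_powr del: power_Suc)
    ultimately have "real (Suc (Suc n)) * (\<Prod>k<Suc n. u k) powr (1 / real (Suc n))
        \<le> (\<Sum>k<Suc n. c k * u k) / real (Suc n)"
      by (simp add: sum_divide_distrib del: sum.lessThan_Suc prod.lessThan_Suc)
    then show ?thesis
      by (subst (asm) pos_le_divide_eq) (simp_all add: pos_le_divide_eq mult_ac del: sum.lessThan_Suc prod.lessThan_Suc of_nat_Suc)
  qed
  have tele: "(\<Sum>n=k..<m. 1 / (real (Suc n) * real (Suc (Suc n)))) \<le> 1 / real (Suc k)" for k
  proof (cases "k \<le> m")
    case True
    have "(\<Sum>n=k..<m. 1 / (real (Suc n) * real (Suc (Suc n))))
        = (\<Sum>n=k..<m. (- 1 / real (Suc (Suc n))) - (- 1 / real (Suc n)))"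
      by (intro sum.cong) (auto simp: field_simps)
    also have "\<dots> = - 1 / real (Suc m) - (- 1 / real (Suc k))"
      by (rule sum_Suc_diff'[OF True])
    finally show ?thesis by simp
  qed simp
  have "(\<Sum>n<m. (\<Prod>k<Suc n. u k) powr (1 / real (Suc n)))
      \<le> (\<Sum>n<m. \<Sum>k<Suc n. c k * u k * (1 / (real (Suc n) * real (Suc (Suc n)))))"
    unfolding sum_distrib_right[symmetric] by (intro sum_mono geo)
  also have "\<dots> = (\<Sum>k<m. \<Sum>n=k..<m. c k * u k * (1 / (real (Suc n) * real (Suc (Suc n)))))"
    by (induction m) (simp_all add: sum.distrib)
  also have "\<dots> \<le> (\<Sum>k<m. c k * u k * (1 / real (Suc k)))"
    unfolding sum_distrib_left[symmetric]
    using nonneg less_imp_le[OF c] by (intro sum_mono mult_left_mono tele) auto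
  also have "\<dots> = (\<Sum>k<m. c k / real (Suc k) * u k)"
    by (intro sum.cong) auto
  also have "\<dots> \<le> (\<Sum>k<m. exp 1 * u k)"
    using nonneg by (intro sum_mono mult_right_mono c_le)
  finally show ?thesis by (simp add: sum_distrib_left)
qed

text \<open>Up to the factor \<open>M 0\<close>, the geometric mean of the first \<open>n\<close> ratios is \<open>1 / a (r * n)\<close>.\<close>

lemma carleman_ratios_not_summable:
  fixes a :: "nat \<Rightarrow> real"
  assumes r: "r > 0" and pos: "\<And>k. a k > 0"
    and mono: "\<And>k l. 0 < k \<Longrightarrow> k \<le> l \<Longrightarrow> a k \<le> C * a l"
    and M: "\<And>n. M n > 0" "\<And>n. n > 0 \<Longrightarrow> M n = a (r * n) ^ n"
    and div: "\<not> summable (\<lambda>k. 1 / a (Suc k))"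
  shows "\<not> summable (\<lambda>n. M n / M (Suc n))"
proof
  define u where "u = (\<lambda>n. M n / M (Suc n))"
  assume "summable (\<lambda>n. M n / M (Suc n))"
  then have u: "summable u" by (simp add: u_def)
  have u_pos: "u n \<ge> 0" for n using less_imp_le[OF M(1)] by (simp add: u_def)
  have prod_u: "(\<Prod>k<n. u k) = M 0 / M n" for n
    using M(1) by (induction n) (auto simp: u_def less_imp_neq[symmetric])
  have "summable (\<lambda>n. (M 0 / M (Suc n)) powr (1 / real (Suc n)))"
  proof (rule summableI_nonneg_bounded)
    fix m
    have "(\<Sum>n<m. (M 0 / M (Suc n)) powr (1 / real (Suc n))) \<le> exp 1 * (\<Sum>k<m. u k)"
      using carleman_inequality[of u m] u_pos unfolding prod_u by simp
    also have "\<dots> \<le> exp 1 * suminf u"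
      using u u_pos by (intro mult_left_mono sum_le_suminf) auto
    finally show "(\<Sum>n<m. (M 0 / M (Suc n)) powr (1 / real (Suc n))) \<le> exp 1 * suminf u" .
  qed auto
  \<comment> \<open>The roots of \<open>M 0\<close> stay above \<open>min 1 (M 0)\<close>; this is
    the origin of the constant \<open>max 1 (1 / M 0)\<close>.\<close>
  moreover have "1 / a (r * Suc n) \<le> max 1 (1 / M 0) * (M 0 / M (Suc n)) powr (1 / real (Suc n))" for n
  proof -
    have "(M 0 / M (Suc n)) powr (1 / real (Suc n)) = M 0 powr (1 / real (Suc n)) / a (r * Suc n)"
    proof -
      have "M (Suc n) powr (1 / real (Suc n)) = (a (r * Suc n) powr real (Suc n)) powr (1 / real (Suc n))"
        using M(2)[of "Suc n"] pos[of "r * Suc n"] by (simp only: powr_realpow zero_less_Suc)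
      also have "\<dots> = a (r * Suc n)"
        using pos[of "r * Suc n"] by (simp only: powr_powr) simp
      finally show ?thesis using M(1) by (simp only: powr_divide less_imp_le)
    qed
    moreover have "1 \<le> max 1 (1 / M 0) * M 0 powr (1 / real (Suc n))"
    proof (cases "M 0 \<ge> 1")
      case True
      then have "1 * 1 \<le> max 1 (1 / M 0) * M 0 powr (1 / real (Suc n))"
        by (intro mult_mono ge_one_powr_ge_zero) auto
      then show ?thesis by simp
    next
      case False
      then have "M 0 powr 1 \<le> M 0 powr (1 / real (Suc n))"
        using M(1)[of 0] by (intro powr_mono') auto
      then have "1 / M 0 * M 0 powr 1 \<le> max 1 (1 / M 0) * M 0 powr (1 / real (Suc n))"
        using M(1)[of 0] by (intro mult_mono) auto
      then show ?thesis using M(1)[of 0] by simp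
    qed
    ultimately show ?thesis using pos[of "r * Suc n"] by (simp add: divide_right_mono less_imp_le)
  qed
  ultimately have sum_r: "summable (\<lambda>n. 1 / a (r * Suc n))"
    using summable_comparison_test'[where N = 0 and f = "\<lambda>n. 1 / a (r * Suc n)"
        and g = "\<lambda>n. max 1 (1 / M 0) * (M 0 / M (Suc n)) powr (1 / real (Suc n))"] pos
    by (simp add: summable_mult less_imp_le)
  have C: "C > 0" using mono[of 1 1] pos[of 1] by (simp add: zero_less_mult_iff)
  have "summable (\<lambda>k. 1 / a (k + r))"
  proof (rule summableI_nonneg_bounded)
    fix m
    \<comment> \<open>The shift by \<open>r\<close> puts the whole block at or beyond the sampled
      index \<open>r * Suc n\<close>, so \<open>mono\<close> compares each of its terms with that
      sample.\<close>
    have block: "(\<Sum>k=n*r..<n*r+r. 1 / a (k + r)) \<le> real r * C * (1 / a (r * Suc n))" for n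
    proof -
      have "1 / a (k + r) \<le> C * (1 / a (r * Suc n))" if "k \<ge> n * r" for k
      proof -
        have "a (r * Suc n) \<le> C * a (k + r)" using that r by (intro mono) (auto simp: algebra_simps)
        then show ?thesis using pos by (simp add: field_simps)
      qed
      then have "(\<Sum>k=n*r..<n*r+r. 1 / a (k + r)) \<le> (\<Sum>k=n*r..<n*r+r. C * (1 / a (r * Suc n)))"
        by (intro sum_mono) auto
      then show ?thesis by (simp add: mult_ac)
    qed
    have "(\<Sum>k<m. 1 / a (k + r)) \<le> (\<Sum>k<m*r. 1 / a (k + r))"
      using r pos by (intro sum_mono2) (auto simp: less_imp_le)
    also have "\<dots> = (\<Sum>n<m. \<Sum>k=n*r..<n*r+r. 1 / a (k + r))"
      by (rule sum.nat_group[symmetric])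
    also have "\<dots> \<le> (\<Sum>n<m. real r * C * (1 / a (r * Suc n)))"
      by (intro sum_mono block)
    also have "\<dots> \<le> (\<Sum>n. real r * C * (1 / a (r * Suc n)))"
      using sum_r C pos by (intro sum_le_suminf summable_mult) (auto simp: less_imp_le)
    finally show "(\<Sum>k<m. 1 / a (k + r)) \<le> (\<Sum>n. real r * C * (1 / a (r * Suc n)))" .
  qed (use pos in \<open>auto simp: less_imp_le\<close>)
  then have "summable (\<lambda>k. 1 / a k)" by (subst (asm) summable_iff_shift)
  then show False using div by (subst (asm) summable_Suc_iff[symmetric]) simp
qed

text \<open>Positive even moments exclude the terms 1/0, so divergence in \<open>ennreal\<close>
  becomes divergence of a real series.\<close>

lemma carleman_imp_not_summable:
  assumes "carleman s" "\<And>k. s (2 * Suc k) > 0"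
  shows "\<not> summable (\<lambda>k. 1 / (s (2 * Suc k) powr (1 / real (2 * Suc k))))"
proof
  define b where "b = (\<lambda>k. s (2 * Suc k) powr (1 / real (2 * Suc k)))"
  have b: "b k > 0" for k using assms(2)[of k] by (simp add: b_def)
  assume "summable (\<lambda>k. 1 / (s (2 * Suc k) powr (1 / real (2 * Suc k))))"
  then have "summable (\<lambda>k. 1 / b k)" by (simp add: b_def)
  then have "(\<Sum>k. ennreal (1 / b k)) \<noteq> \<infinity>"
    using b by (subst suminf_ennreal2) (auto simp: less_imp_le)
  moreover have "1 / ennreal (b k) = ennreal (1 / b k)" for k
    using b[of k] divide_ennreal[of 1 "b k"] by (simp add: less_imp_le)
  ultimately show False using assms(1) by (simp add: carleman_def b_def)
qed

text \<open>The exponents of the roots are at most 1, so a factor \<open>c \<ge> 1\<close> in the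
  moments costs at most \<open>c\<close> in the roots. It serves the sum of two measures with equal
  moments, where \<open>c = 2\<close>.\<close>

lemma carleman_mono_factor:
  assumes s: "carleman s" and c: "c \<ge> 1"
    and nonneg: "\<And>k. s (2 * Suc k) \<ge> 0" "\<And>k. s' (2 * Suc k) \<ge> 0"
    and le: "\<And>k. s' (2 * Suc k) \<le> c * s (2 * Suc k)"
  shows "carleman s'"
proof -
  define a where "a = (\<lambda>k. s (2 * Suc k) powr (1 / real (2 * Suc k)))"
  define b where "b = (\<lambda>k. s' (2 * Suc k) powr (1 / real (2 * Suc k)))"
  have ba: "b k \<le> c * a k" for k
  proof -
    have "b k \<le> (c * s (2 * Suc k)) powr (1 / real (2 * Suc k))"
      unfolding b_def using le nonneg by (intro powr_mono2) auto
    also have "\<dots> = c powr (1 / real (2 * Suc k)) * a k"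
      unfolding a_def using c nonneg by (intro powr_mult)
    also have "\<dots> \<le> c powr 1 * a k"
      using c by (intro mult_right_mono powr_mono) (auto simp: a_def)
    finally show ?thesis using c by simp
  qed
  have "1 / ennreal (a k) \<le> ennreal c * (1 / ennreal (b k))" for k
  proof (cases "b k = 0")
    \<comment> \<open>The term belonging to \<open>s'\<close> is infinite here.\<close>
    case True
    then show ?thesis using c by (simp add: ennreal_mult_top)
  next
    case False
    then have "b k > 0" by (simp add: b_def)
    then have "0 < c * a k" using ba[of k] by linarith
    then have "a k > 0" using c by (auto simp: zero_less_mult_iff)
    with \<open>b k > 0\<close> show ?thesis
      using ba[of k] c divide_ennreal[of 1 "a k"] divide_ennreal[of 1 "b k"]
      by (simp add: ennreal_mult[symmetric] field_simps)
  qed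
  then have "(\<Sum>k. 1 / ennreal (a k)) \<le> (\<Sum>k. ennreal c * (1 / ennreal (b k)))"
    by (intro suminf_le) auto
  then have "ennreal c * (\<Sum>k. 1 / ennreal (b k)) = \<infinity>"
    using s by (simp add: carleman_def a_def top_unique)
  then show ?thesis
    by (simp add: carleman_def b_def ennreal_mult_eq_top_iff)
qed

section \<open>Distance to a closed subspace\<close>

definition ldist :: "real \<Rightarrow> 'a measure \<Rightarrow> ('a \<Rightarrow> complex) set \<Rightarrow> ('a \<Rightarrow> complex) \<Rightarrow> real" where
  "ldist p M V h = (INF q\<in>V. lnorm p M (\<lambda>v. h v - q v))"

lemma ldist_le: "q \<in> V \<Longrightarrow> ldist p M V h \<le> lnorm p M (\<lambda>v. h v - q v)"
  unfolding ldist_def by (intro cINF_lower bdd_belowI2[of _ 0] lnorm_nonneg)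

context
  fixes p :: real and M :: "'a measure" and V
  assumes p: "p \<ge> 1" and V: "closed_subspace p M V"
begin

lemma ldist_less: "ldist p M V h < e \<Longrightarrow> \<exists>q\<in>V. lnorm p M (\<lambda>v. h v - q v) < e"
  unfolding ldist_def using closed_subspace_zero[OF V]
  by (subst (asm) cINF_less_iff) (auto intro!: bdd_belowI2[of _ 0] lnorm_nonneg)

lemma ldist_le_lnorm: "ldist p M V h \<le> lnorm p M h"
  using ldist_le[OF closed_subspace_zero[OF V], of p M h] by simp

lemma ldist_mem: "h \<in> V \<Longrightarrow> ldist p M V h \<le> 0"
  using ldist_le[of h V p M h] by (simp add: lnorm_def)

text \<open>Closedness of \<open>V\<close> enters the distance estimates here: a vanishing distance
  is all that Bang's criterion delivers.\<close>

lemma mem_of_ldist: "h \<in> lspace p M \<Longrightarrow> ldist p M V h \<le> 0 \<Longrightarrow> h \<in> V"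
  by (rule closed_subspace_closed[OF V]) (auto intro!: ldist_less)

lemma ldist_triangle:
  assumes h: "h \<in> lspace p M" and k: "k \<in> lspace p M"
  shows "ldist p M V (\<lambda>v. h v + k v) \<le> ldist p M V h + ldist p M V k"
proof (rule field_le_epsilon)
  fix e :: real assume "e > 0"
  then obtain q r where q: "q \<in> V" "lnorm p M (\<lambda>v. h v - q v) < ldist p M V h + e / 2"
    and r: "r \<in> V" "lnorm p M (\<lambda>v. k v - r v) < ldist p M V k + e / 2"
    using ldist_less[of h "ldist p M V h + e / 2"] ldist_less[of k "ldist p M V k + e / 2"] by auto
  have "ldist p M V (\<lambda>v. h v + k v) \<le> lnorm p M (\<lambda>v. h v + k v - (q v + r v))"
    by (intro ldist_le closed_subspace_add[OF V] q r)
  also have "\<dots> = lnorm p M (\<lambda>v. (h v - q v) + (k v - r v))" by (simp add: algebra_simps)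
  also have "\<dots> \<le> lnorm p M (\<lambda>v. h v - q v) + lnorm p M (\<lambda>v. k v - r v)"
    using closed_subspace_lspace[OF V q(1)] closed_subspace_lspace[OF V r(1)] h k p
    by (intro lnorm_triangle lspace_diff)
  finally show "ldist p M V (\<lambda>v. h v + k v) \<le> ldist p M V h + ldist p M V k + e"
    using q(2) r(2) by simp
qed

lemma ldist_cmult:
  assumes h: "h \<in> lspace p M"
  shows "ldist p M V (\<lambda>v. c * h v) \<le> norm c * ldist p M V h"
proof (rule field_le_epsilon)
  fix e :: real assume "e > 0"
  then have "e / (norm c + 1) > 0" by (simp add: add_nonneg_pos)
  then obtain q where q: "q \<in> V" "lnorm p M (\<lambda>v. h v - q v) < ldist p M V h + e / (norm c + 1)"
    using ldist_less[of h "ldist p M V h + e / (norm c + 1)"] by auto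
  have "ldist p M V (\<lambda>v. c * h v) \<le> lnorm p M (\<lambda>v. c * h v - c * q v)"
    by (intro ldist_le closed_subspace_cmult[OF V] q)
  also have "\<dots> = lnorm p M (\<lambda>v. c * (h v - q v))" by (simp add: algebra_simps)
  also have "\<dots> = norm c * lnorm p M (\<lambda>v. h v - q v)"
    using closed_subspace_lspace[OF V q(1)] h p by (intro lspace_cmult lspace_diff) auto
  also have "\<dots> \<le> norm c * (ldist p M V h + e / (norm c + 1))"
    using q(2) by (intro mult_left_mono) auto
  also have "\<dots> \<le> norm c * ldist p M V h + e"
  proof -
    have "norm c * (e / (norm c + 1)) \<le> (norm c + 1) * (e / (norm c + 1))"
      using \<open>e / (norm c + 1) > 0\<close> by (intro mult_right_mono) auto
    also have "\<dots> = e" using norm_ge_zero[of c] by (simp add: add_nonneg_eq_0_iff)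
    finally show ?thesis by (simp add: distrib_left)
  qed
  finally show "ldist p M V (\<lambda>v. c * h v) \<le> norm c * ldist p M V h + e" .
qed

lemma ldist_sum:
  assumes "finite I" "\<And>i. i \<in> I \<Longrightarrow> h i \<in> lspace p M"
  shows "ldist p M V (\<lambda>v. \<Sum>i\<in>I. h i v) \<le> (\<Sum>i\<in>I. ldist p M V (h i))"
  using assms
proof (induction I rule: finite_induct)
  case empty
  then show ?case using ldist_mem[OF closed_subspace_zero[OF V]] by simp
next
  case (insert j J)
  then show ?case
    using ldist_triangle[of "h j" "\<lambda>v. \<Sum>i\<in>J. h i v"] lspace_sum[OF p, of J h M] by fastforce
qed

end

section \<open>Norm estimates by even moments\<close>

lemma powr_le_one_plus_power:
  fixes y q :: real
  assumes "y \<ge> 0" "0 < q" "q \<le> real m"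
  shows "y powr q \<le> 1 + y ^ m"
proof (cases "y \<le> 1")
  case True
  then have "y powr q \<le> 1 powr q" using assms by (intro powr_mono2) auto
  moreover have "0 \<le> y ^ m" using assms by simp
  ultimately show ?thesis unfolding powr_one_eq_one by linarith
next
  case False
  then have "y powr q \<le> y powr real m" using assms by (intro powr_mono) auto
  also have "\<dots> = y ^ m" using False by (intro powr_realpow) auto
  finally show ?thesis by simp
qed

text \<open>With \<open>b = \<bar>y\<bar> / a\<close>, the product of the p-th powers of
  \<open>b\<close> and \<open>norm g\<close> is bounded by the sum of their squares, and
  \<open>b powr (2 * p)\<close> by \<open>1 + b ^ (2 * r)\<close>. Scaling by \<open>a\<close> makes
  the bound proportional to \<open>a\<close> with a constant that does not depend on
  \<open>y\<close>; later \<open>y\<close> runs through all powers of one function and the constant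
  must stay the same.\<close>

lemma weighted_lnorm_le:
  fixes y :: "'a \<Rightarrow> real" and g h :: "'a \<Rightarrow> complex"
  assumes "finite_measure M" and p: "p \<ge> 1" "p \<le> real r"
    and y: "y \<in> borel_measurable M" "integrable M (\<lambda>v. y v ^ (2 * r))"
    and a: "a > 0" "(LINT v|M. y v ^ (2 * r)) \<le> a ^ (2 * r)"
    and g: "integrable M (\<lambda>v. norm (g v) powr (2 * p))"
    and h: "h \<in> borel_measurable M" "\<And>v. norm (h v) \<le> \<bar>y v\<bar> * norm (g v)"
  shows "h \<in> lspace p M"
    "lnorm p M h \<le> (measure M (space M) + 1 + (LINT v|M. norm (g v) powr (2 * p))) powr (1 / p) * a"
proof -
  interpret finite_measure M by fact
  define w where "w = (\<lambda>v. a powr p * (1 + y v ^ (2 * r) / a ^ (2 * r) + norm (g v) powr (2 * p)))"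
  have le: "norm (h v) powr p \<le> w v" for v
  proof -
    define b where "b = \<bar>y v\<bar> / a"
    have b: "b \<ge> 0" using a by (simp add: b_def)
    have "norm (h v) powr p \<le> (a * (b * norm (g v))) powr p"
      using h(2)[of v] a p by (intro powr_mono2) (auto simp: b_def)
    also have "\<dots> = a powr p * (b powr p * norm (g v) powr p)"
      using a b by (simp add: powr_mult)
    also have "\<dots> \<le> a powr p * (1 + y v ^ (2 * r) / a ^ (2 * r) + norm (g v) powr (2 * p))"
    proof (intro mult_left_mono)
      have "0 \<le> (b powr p - norm (g v) powr p)\<^sup>2" by simp
      then have "b powr p * norm (g v) powr p \<le> (b powr p)\<^sup>2 / 2 + (norm (g v) powr p)\<^sup>2 / 2"
        by (simp add: power2_eq_square algebra_simps)
      also have "\<dots> \<le> (b powr p)\<^sup>2 + (norm (g v) powr p)\<^sup>2"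
        using zero_le_power2[of "b powr p"] zero_le_power2[of "norm (g v) powr p"] by linarith
      also have "\<dots> = b powr (2 * p) + norm (g v) powr (2 * p)"
        by (simp add: power2_eq_square powr_add[symmetric])
      also have "b powr (2 * p) \<le> 1 + b ^ (2 * r)"
        using b p by (intro powr_le_one_plus_power) auto
      also have "b ^ (2 * r) = y v ^ (2 * r) / a ^ (2 * r)"
        by (simp add: b_def power_divide power_even_abs)
      finally show "b powr p * norm (g v) powr p \<le> 1 + y v ^ (2 * r) / a ^ (2 * r) + norm (g v) powr (2 * p)"
        by simp
    qed simp
    finally show ?thesis by (simp add: w_def)
  qed
  have iw: "integrable M w" unfolding w_def using y g by (intro integrable_mult_right Bochner_Integration.integrable_add) auto
  have ih: "integrable M (\<lambda>v. norm (h v) powr p)"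
    by (rule Bochner_Integration.integrable_bound[OF iw]) (use le h in \<open>auto intro: order_trans[OF _ abs_ge_self]\<close>)
  then show "h \<in> lspace p M" using h by (simp add: lspace_def)
  \<comment> \<open>The three summands bound the integrals of the constant 1, of
    \<open>y ^ (2 * r) / a ^ (2 * r)\<close> and of the power of \<open>g\<close>.\<close>
  define D where "D = measure M (space M) + 1 + (LINT v|M. norm (g v) powr (2 * p))"
  have D: "D \<ge> 0" unfolding D_def by (intro add_nonneg_nonneg Bochner_Integration.integral_nonneg) auto
  have "(LINT v|M. norm (h v) powr p) \<le> (LINT v|M. w v)" by (intro integral_mono ih iw le)
  also have "\<dots> = a powr p * (measure M (space M) + (LINT v|M. y v ^ (2 * r)) / a ^ (2 * r)
      + (LINT v|M. norm (g v) powr (2 * p)))"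
    unfolding w_def using y g by (simp add: Bochner_Integration.integral_add)
  also have "\<dots> \<le> a powr p * D"
    unfolding D_def using a by (intro mult_left_mono add_mono) (auto simp: divide_le_eq)
  also have "\<dots> = (D powr (1 / p) * a) powr p"
    using p D a by (simp add: powr_mult powr_powr)
  finally show "lnorm p M h \<le> D powr (1 / p) * a"
    using p a by (intro lnorm_le) auto
qed

text \<open>Here \<open>m\<close> counts the Taylor terms, and \<open>m = 0\<close> gives the
  trivial bound 1 for the exponential. This matches the remainder in
  \<open>bang_vanishing\<close>.\<close>

lemma norm_iexp_minus_taylor_le:
  "cmod (iexp x - (\<Sum>k<m. (\<i> * complex_of_real x) ^ k / fact k)) \<le> \<bar>x\<bar> ^ m / fact m"
proof (cases m)
  case (Suc n)
  then show ?thesis using iexp_approx1[of x n] by (simp add: lessThan_Suc_atMost)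
qed simp

text \<open>\<open>b ^ (2 * k) \<le> 1 + b ^ (2 * l)\<close> is integrated for \<open>b = \<bar>x\<bar> / a\<close>, with \<open>a\<close> the root on the right.\<close>

lemma even_moment_root_mono:
  fixes x :: "'a \<Rightarrow> real"
  assumes "finite_measure M" and int: "\<And>k. integrable M (\<lambda>v. x v ^ k)"
    and pos: "\<And>k. (LINT v|M. x v ^ (2 * k)) > 0" and kl: "0 < k" "k \<le> l"
  shows "(LINT v|M. x v ^ (2 * k)) powr (1 / real (2 * k))
    \<le> (measure M (space M) + 1) * (LINT v|M. x v ^ (2 * l)) powr (1 / real (2 * l))"
proof -
  interpret finite_measure M by fact
  define a where "a = (LINT v|M. x v ^ (2 * l)) powr (1 / real (2 * l))"
  have a: "a > 0" using pos[of l] by (simp add: a_def)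
  have al: "a ^ (2 * l) = (LINT v|M. x v ^ (2 * l))"
    unfolding a_def using kl pos[of l] by (subst powr_realpow[symmetric]) (simp_all add: powr_powr)
  have pw: "x v ^ (2 * k) \<le> a ^ (2 * k) * (1 + x v ^ (2 * l) / a ^ (2 * l))" for v
  proof -
    define b where "b = \<bar>x v\<bar> / a"
    have b: "b \<ge> 0" using a by (simp add: b_def)
    have "b ^ (2 * k) \<le> 1 + b ^ (2 * l)"
    proof (cases "b \<le> 1")
      case True
      then show ?thesis using b power_le_one[of b "2 * k"] by (simp add: add_increasing2)
    next
      case False
      then show ?thesis using power_increasing[of "2 * k" "2 * l" b] kl by linarith
    qed
    then have "a ^ (2 * k) * b ^ (2 * k) \<le> a ^ (2 * k) * (1 + b ^ (2 * l))"
      using a by (intro mult_left_mono) auto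
    then show ?thesis using a by (simp add: b_def power_divide power_even_abs)
  qed
  have "(LINT v|M. x v ^ (2 * k)) \<le> (LINT v|M. a ^ (2 * k) * (1 + x v ^ (2 * l) / a ^ (2 * l)))"
    by (intro integral_mono int pw) (auto intro!: int)
  also have "\<dots> = a ^ (2 * k) * (measure M (space M) + 1)"
    using a int[of "2 * l"] pos[of l] by (simp add: al[symmetric])
  also have "\<dots> \<le> a ^ (2 * k) * (measure M (space M) + 1) ^ (2 * k)"
    using kl a self_le_power[of "measure M (space M) + 1" "2 * k"] by (intro mult_left_mono) auto
  also have "\<dots> = (a * (measure M (space M) + 1)) ^ (2 * k)" by (simp add: power_mult_distrib)
  also have "\<dots> = (a * (measure M (space M) + 1)) powr real (2 * k)"
    using a by (intro powr_realpow[symmetric]) (auto simp: add_nonneg_pos)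
  finally have "(LINT v|M. x v ^ (2 * k)) powr (1 / real (2 * k))
      \<le> ((a * (measure M (space M) + 1)) powr real (2 * k)) powr (1 / real (2 * k))"
    using pos[of k] by (intro powr_mono2) auto
  also have "\<dots> = a * (measure M (space M) + 1)"
    using kl a by (intro powr_inverse_powr) auto
  finally show ?thesis by (simp add: a_def mult.commute)
qed

text \<open>In the notation of the proof, the nonnegative integral of
  \<open>(C * y v - B * z v)\<^sup>2\<close> equals \<open>C * (A * C - B\<^sup>2)\<close>, and the
  positive \<open>C\<close> can be cancelled.\<close>

lemma integral_mult_le_sqrt:
  fixes y z :: "'a \<Rightarrow> real"
  assumes "integrable M (\<lambda>v. y v * z v)" "integrable M (\<lambda>v. (y v)\<^sup>2)" "integrable M (\<lambda>v. (z v)\<^sup>2)"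
    and "(LINT v|M. (y v)\<^sup>2) > 0" "(LINT v|M. (z v)\<^sup>2) > 0"
  shows "(LINT v|M. y v * z v)\<^sup>2 \<le> (LINT v|M. (y v)\<^sup>2) * (LINT v|M. (z v)\<^sup>2)"
proof -
  define A B C where "A = (LINT v|M. (y v)\<^sup>2)" and "B = (LINT v|M. y v * z v)" and "C = (LINT v|M. (z v)\<^sup>2)"
  have "0 \<le> (LINT v|M. (C * y v - B * z v)\<^sup>2)" by simp
  also have "\<dots> = (LINT v|M. C\<^sup>2 * (y v)\<^sup>2 - 2 * B * C * (y v * z v) + B\<^sup>2 * (z v)\<^sup>2)"
    by (intro Bochner_Integration.integral_cong) (auto simp: power2_eq_square algebra_simps)
  also have "\<dots> = C\<^sup>2 * A - 2 * B * C * B + B\<^sup>2 * C"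
    using assms by (simp add: A_def B_def C_def)
  also have "\<dots> = C * (A * C - B\<^sup>2)" by (simp add: power2_eq_square algebra_simps)
  finally show ?thesis using assms(5) by (simp add: A_def B_def C_def zero_le_mult_iff)
qed

text \<open>An application of \<open>bang_vanishing\<close> with \<open>t\<close> as time:
  \<open>A n t\<close> is the distance from \<open>x ^ n * iexp (t * x) * g\<close> to
  \<open>V\<close>, up to a constant factor. The hypothesis \<open>mem\<close> says that these
  distances vanish at time 0 for all \<open>n\<close>; the conclusion is the case
  \<open>n = 0\<close> at time \<open>t\<close>.\<close>

lemma exp_mult_mem_nonneg:
  fixes x :: "'a \<Rightarrow> real" and g :: "'a \<Rightarrow> complex"
  assumes fin: "finite_measure M" and p: "p \<ge> 1" and V: "closed_subspace p M V"
    and xm [measurable]: "x \<in> borel_measurable M" and int: "\<And>k. integrable M (\<lambda>v. x v ^ k)"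
    and carl: "carleman (\<lambda>k. LINT v|M. x v ^ k)"
    and gm [measurable]: "g \<in> borel_measurable M" and gi: "integrable M (\<lambda>v. norm (g v) powr (2 * p))"
    and mem: "\<And>k. (\<lambda>v. complex_of_real (x v ^ k) * g v) \<in> V"
    and t: "t \<ge> 0"
  shows "(\<lambda>v. iexp (t * x v) * g v) \<in> V"
proof (cases "AE v in M. x v = 0")
  \<comment> \<open>The moments of positive order vanish, so the ratios used in the other case would
    be meaningless; but the exponential is 1 almost everywhere.\<close>
  case True
  have "g \<in> V" using mem[of 0] by simp
  then show ?thesis
    by (rule closed_subspace_AE_cong[OF p V]) (use True in auto)
next
  case False
  interpret finite_measure M by fact
  define s where "s = (\<lambda>k. LINT v|M. x v ^ (2 * k))"
  have s: "s k > 0" for k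
  proof -
    have "s k \<ge> 0" unfolding s_def by (intro Bochner_Integration.integral_nonneg) auto
    moreover have "s k \<noteq> 0"
    proof
      assume "s k = 0"
      then have "AE v in M. x v ^ (2 * k) = 0"
        unfolding s_def using int by (subst (asm) integral_nonneg_eq_0_iff_AE) auto
      then show False using False by auto
    qed
    ultimately show ?thesis by simp
  qed
  define r where "r = nat \<lceil>p\<rceil>"
  have r: "r > 0" "p \<le> real r" using p unfolding r_def by linarith+
  define a where "a = (\<lambda>k. s k powr (1 / real (2 * k)))"
  \<comment> \<open>\<open>N n\<close> is the norm of \<open>x ^ n\<close> in L_(2r). Since
    \<open>r\<close> is an integer, only moments occur in it, and \<open>2 * r \<ge> 2 * p\<close>
    is what \<open>weighted_lnorm_le\<close> demands.\<close>
  define N where "N = (\<lambda>n. s (r * n) powr (1 / real (2 * r)))"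
  have N: "N n > 0" for n using s[of "r * n"] by (simp add: N_def)
  have N_pow: "N n ^ (2 * r) = s (r * n)" for n
    using s[of "r * n"] r by (simp add: N_def powr_powr flip: powr_realpow)
  have N_a: "N n = a (r * n) ^ n" if "n > 0" for n
    using s[of "r * n"] r that by (simp add: N_def a_def powr_powr flip: powr_realpow)
  have conv: "N (Suc n) ^ 2 \<le> N n * N (Suc (Suc n))" for n
  proof -
    have "(LINT v|M. x v ^ (r * n) * x v ^ (r * (n + 2)))\<^sup>2
        \<le> (LINT v|M. (x v ^ (r * n))\<^sup>2) * (LINT v|M. (x v ^ (r * (n + 2)))\<^sup>2)"
      using s[of "r * n"] s[of "r * (n + 2)"] int
      by (intro integral_mult_le_sqrt)
        (auto simp: s_def power_mult[symmetric] power_add[symmetric] mult.commute[of _ 2] simp del: power_even_eq)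
    also have "(\<lambda>v. x v ^ (r * n) * x v ^ (r * (n + 2))) = (\<lambda>v. x v ^ (2 * (r * Suc n)))"
    proof -
      have "r * n + r * (n + 2) = 2 * (r * Suc n)" by (simp add: algebra_simps)
      then show ?thesis by (simp only: power_add[symmetric])
    qed
    also have "(\<lambda>v. (x v ^ (r * n))\<^sup>2) = (\<lambda>v. x v ^ (2 * (r * n)))"
      by (auto simp: power_mult[symmetric] mult.commute[of _ 2])
    also have "(\<lambda>v. (x v ^ (r * (n + 2)))\<^sup>2) = (\<lambda>v. x v ^ (2 * (r * (n + 2))))"
      by (simp only: power_mult[symmetric] mult.commute[of _ 2])
    finally have "(s (r * Suc n))\<^sup>2 \<le> s (r * n) * s (r * Suc (Suc n))" by (simp add: s_def)
    then have "(N (Suc n) ^ 2) ^ (2 * r) \<le> (N n * N (Suc (Suc n))) ^ (2 * r)"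
    proof -
      have "(N (Suc n) ^ 2) ^ (2 * r) = (N (Suc n) ^ (2 * r))\<^sup>2"
        by (simp only: power_mult[symmetric] mult.commute)
      with \<open>(s (r * Suc n))\<^sup>2 \<le> _\<close> show ?thesis
        by (simp only: power_mult_distrib N_pow)
    qed
    then show ?thesis
      by (subst (asm) power_mono_iff) (use N r in \<open>auto simp: less_imp_le\<close>)
  qed
  have div: "\<not> summable (\<lambda>n. N n / N (Suc n))"
  proof (rule carleman_ratios_not_summable[OF r(1)])
    show "a k > 0" for k using s[of k] by (simp add: a_def)
    show "a k \<le> (measure M (space M) + 1) * a l" if "0 < k" "k \<le> l" for k l
      unfolding a_def s_def using s unfolding s_def by (intro even_moment_root_mono fin int that) auto
    show "\<not> summable (\<lambda>k. 1 / a (Suc k))"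
      using carleman_imp_not_summable[OF carl] s unfolding a_def s_def by blast
  qed (use N N_a in auto)
  define C where "C = (measure M (space M) + 1 + (LINT v|M. norm (g v) powr (2 * p))) powr (1 / p)"
  have C: "C > 0"
  proof -
    have "0 < measure M (space M) + 1 + (LINT v|M. norm (g v) powr (2 * p))"
      by (intro add_pos_nonneg add_nonneg_pos Bochner_Integration.integral_nonneg) auto
    then show ?thesis unfolding C_def powr_gt_zero by linarith
  qed
  have bound: "h \<in> lspace p M" "lnorm p M h \<le> C * N n"
    if "h \<in> borel_measurable M" "\<And>v. norm (h v) \<le> \<bar>x v ^ n\<bar> * norm (g v)" for h n
  proof -
    have eq: "(\<lambda>v. (x v ^ n) ^ (2 * r)) = (\<lambda>v. x v ^ (2 * (r * n)))"
      by (simp add: power_mult[symmetric] mult_ac)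
    have "integrable M (\<lambda>v. (x v ^ n) ^ (2 * r))" "(LINT v|M. (x v ^ n) ^ (2 * r)) \<le> N n ^ (2 * r)"
      unfolding eq N_pow by (auto simp: s_def int)
    from weighted_lnorm_le[OF fin p r(2) _ this(1) N this(2) gi that]
    show "h \<in> lspace p M" "lnorm p M h \<le> C * N n" by (auto simp: C_def)
  qed
  define F where "F = (\<lambda>n t v. complex_of_real (x v ^ n) * (iexp (t * x v) * g v))"
  have Fm [measurable]: "F n t \<in> borel_measurable M" for n t unfolding F_def by measurable
  have F_le: "norm (F n t v) \<le> \<bar>x v ^ n\<bar> * norm (g v)" for n t v
    by (simp add: F_def norm_mult norm_power power_abs)
  note F = bound[OF Fm F_le]
  \<comment> \<open>Division by \<open>C\<close> turns the a priori bound into \<open>N n\<close>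
    itself, as \<open>bang_vanishing\<close> requires; the Taylor estimate is homogeneous and
    survives the scaling.\<close>
  define A where "A = (\<lambda>n t. ldist p M V (F n t) / C)"
  have "A 0 t \<le> 0"
  proof (rule bang_vanishing[OF N conv _ _ _ div t])
    show "A n t \<le> N n" for n t
      using order_trans[OF ldist_le_lnorm[OF p V, of "F n t"] F(2)[of n t]] C
      by (simp add: A_def field_simps)
    have "F n 0 \<in> V" for n using mem[of n] by (simp add: F_def)
    then show "A n 0 \<le> 0" for n
      using ldist_mem[OF p V, of "F n 0"] C by (simp add: A_def divide_le_0_iff)
    show "A n (t + h) \<le> (\<Sum>k<m. h ^ k / fact k * A (n + k) t) + h ^ m / fact m * N (n + m)"
      if h: "h \<ge> 0" for n m t h
    proof -
      \<comment> \<open>Coefficients of the Taylor expansion of \<open>iexp (h * x v)\<close>; the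
        power of \<open>x v\<close> in the k-th term is absorbed by the passage from
        \<open>F n\<close> to \<open>F (n + k)\<close>.\<close>
      define c where "c = (\<lambda>k. complex_of_real (h ^ k / fact k) * \<i> ^ k)"
      have nc: "norm (c k) = h ^ k / fact k" for k using h by (simp add: c_def norm_mult norm_power norm_divide)
      define R where "R = (\<lambda>v. F n t v * (iexp (h * x v) - (\<Sum>k<m. (\<i> * complex_of_real (h * x v)) ^ k / fact k)))"
      define B where "B = (\<lambda>v. c m * F (n + m) t v)"
      have Rm: "R \<in> borel_measurable M" unfolding R_def by measurable
      have B: "B \<in> lspace p M" "lnorm p M B = h ^ m / fact m * lnorm p M (F (n + m) t)"
        using lspace_cmult[OF _ F(1)] p by (auto simp: B_def nc)
      have RB: "norm (R v) \<le> norm (B v)" for v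
      proof -
        have "norm (R v) \<le> norm (F n t v) * (\<bar>h * x v\<bar> ^ m / fact m)"
          unfolding R_def norm_mult by (intro mult_left_mono norm_iexp_minus_taylor_le) auto
        also have "\<dots> = norm (B v)"
          unfolding B_def norm_mult nc using h by (simp add: F_def norm_mult norm_power power_add power_mult_distrib abs_mult)
        finally show ?thesis .
      qed
      have R: "R \<in> lspace p M" "lnorm p M R \<le> lnorm p M B"
        using lspace_dominated[OF _ B(1) Rm] RB p by auto
      have FtR: "F n (t + h) = (\<lambda>v. (\<Sum>k<m. c k * F (n + k) t v) + R v)"
      proof
        fix v
        have "(\<Sum>k<m. c k * F (n + k) t v) = F n t v * (\<Sum>k<m. (\<i> * complex_of_real (h * x v)) ^ k / fact k)"
          unfolding sum_distrib_left
          by (intro sum.cong) (simp_all add: c_def F_def power_add power_mult_distrib mult_ac)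
        moreover have "F n (t + h) v = F n t v * iexp (h * x v)"
          by (simp add: F_def distrib_right distrib_left exp_add mult_ac)
        ultimately show "F n (t + h) v = (\<Sum>k<m. c k * F (n + k) t v) + R v"
          by (simp add: R_def algebra_simps)
      qed
      have cF: "(\<lambda>v. c k * F (n + k) t v) \<in> lspace p M" for k
        using lspace_cmult(1)[OF _ F(1)] p by simp
      have "ldist p M V (F n (t + h)) \<le> ldist p M V (\<lambda>v. \<Sum>k<m. c k * F (n + k) t v) + ldist p M V R"
        unfolding FtR by (intro ldist_triangle[OF p V] lspace_sum[OF p] cF R)
      also have "\<dots> \<le> (\<Sum>k<m. ldist p M V (\<lambda>v. c k * F (n + k) t v)) + lnorm p M B"
        by (intro add_mono ldist_sum[OF p V] cF finite_lessThan order_trans[OF ldist_le_lnorm[OF p V] R(2)])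
      also have "\<dots> \<le> (\<Sum>k<m. h ^ k / fact k * ldist p M V (F (n + k) t)) + h ^ m / fact m * (C * N (n + m))"
      proof (intro add_mono sum_mono)
        show "ldist p M V (\<lambda>v. c k * F (n + k) t v) \<le> h ^ k / fact k * ldist p M V (F (n + k) t)" for k
          using ldist_cmult[OF p V F(1), of "c k"] by (simp add: nc)
        show "lnorm p M B \<le> h ^ m / fact m * (C * N (n + m))"
          unfolding B(2) using h by (intro mult_left_mono F) auto
      qed
      finally have "A n (t + h) \<le> ((\<Sum>k<m. h ^ k / fact k * ldist p M V (F (n + k) t))
          + h ^ m / fact m * (C * N (n + m))) / C"
        unfolding A_def using C by (intro divide_right_mono) auto
      also have "\<dots> = (\<Sum>k<m. h ^ k / fact k * A (n + k) t) + h ^ m / fact m * N (n + m)"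
        using C by (simp add: A_def add_divide_distrib sum_divide_distrib)
      finally show ?thesis .
    qed
  qed
  then have "ldist p M V (F 0 t) \<le> 0" using C by (simp add: A_def divide_le_0_iff)
  then have "F 0 t \<in> V" using F(1) by (intro mem_of_ldist[OF p V])
  then show ?thesis by (simp add: F_def)
qed

text \<open>Negative times are reached by reflecting \<open>x\<close> to \<open>- x\<close>, which
  preserves the even moments and therefore Carleman's condition.\<close>

lemma exp_mult_mem:
  fixes x :: "'a \<Rightarrow> real" and g :: "'a \<Rightarrow> complex"
  assumes fin: "finite_measure M" and p: "p \<ge> 1" and V: "closed_subspace p M V"
    and xm: "x \<in> borel_measurable M" and int: "\<And>k. integrable M (\<lambda>v. x v ^ k)"
    and carl: "carleman (\<lambda>k. LINT v|M. x v ^ k)"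
    and g: "g \<in> borel_measurable M" "integrable M (\<lambda>v. norm (g v) powr (2 * p))"
    and mem: "\<And>k. (\<lambda>v. complex_of_real (x v ^ k) * g v) \<in> V"
  shows "(\<lambda>v. iexp (t * x v) * g v) \<in> V"
proof (cases "t \<ge> 0")
  case True
  then show ?thesis by (rule exp_mult_mem_nonneg[OF assms])
next
  case False
  have "(\<lambda>v. iexp ((- t) * (- x v)) * g v) \<in> V"
  proof (rule exp_mult_mem_nonneg[OF fin p V _ _ _ g])
    show "integrable M (\<lambda>v. (- x v) ^ k)" for k
      using integrable_mult_right[OF int, of "(-1) ^ k" k] by (simp add: power_minus[of "x _"])
    show "carleman (\<lambda>k. LINT v|M. (- x v) ^ k)" using carl by (simp add: carleman_def)
    show "(\<lambda>v. complex_of_real ((- x v) ^ k) * g v) \<in> V" for k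
      using closed_subspace_cmult[OF V mem, of "(-1) ^ k" k] by (simp add: power_minus[of "x _"] mult_ac)
  qed (use xm False in auto)
  then show ?thesis by simp
qed

section \<open>Exponentials in closed subspaces\<close>

lemma monom_at_add: "monom_at x (\<lambda>i. \<alpha> i + \<beta> i) = monom_at x \<alpha> * monom_at x \<beta>"
  by (simp add: monom_at_def power_add prod.distrib)

lemma monom_at_single: "monom_at x (\<lambda>i. if i = n then k else 0) = (x $ n) ^ k"
proof -
  have "monom_at x (\<lambda>i. if i = n then k else 0) = (\<Prod>i\<in>UNIV. if i = n then (x $ i) ^ k else 1)"
    unfolding monom_at_def by (intro prod.cong) auto
  then show ?thesis by simp
qed

lemma monom_at_power: "monom_at x \<alpha> ^ k = monom_at x (\<lambda>i. \<alpha> i * k)"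
  by (simp add: monom_at_def power_mult prod_power_distrib)

lemma monom_at_zero: "monom_at x (\<lambda>_. 0) = 1"
  by (simp add: monom_at_def)

lemma borel_measurable_monom_at [measurable]:
  fixes X :: "'a \<Rightarrow> real ^ 'n"
  assumes [measurable]: "X \<in> borel_measurable M"
  shows "(\<lambda>v. monom_at (X v) \<alpha>) \<in> borel_measurable M"
proof -
  have [measurable]: "(\<lambda>v. X v $ i) \<in> borel_measurable M" for i
    using measurable_compose[OF assms borel_measurable_nth] .
  show ?thesis unfolding monom_at_def by measurable
qed

lemma integrable_powr_of_even_powers:
  fixes y :: "'a \<Rightarrow> real"
  assumes "finite_measure M" "y \<in> borel_measurable M" "\<And>k. integrable M (\<lambda>v. y v ^ (2 * k))" "q > 0"
  shows "integrable M (\<lambda>v. \<bar>y v\<bar> powr q)"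
proof -
  interpret finite_measure M by fact
  have "integrable M (\<lambda>v. 1 + y v ^ (2 * nat \<lceil>q\<rceil>))" using assms(3) by simp
  then show ?thesis
  proof (rule Bochner_Integration.integrable_bound)
    have "q \<le> real (2 * nat \<lceil>q\<rceil>)" using assms(4) by linarith
    then have "\<bar>y v\<bar> powr q \<le> 1 + \<bar>y v\<bar> ^ (2 * nat \<lceil>q\<rceil>)" for v
      using assms(4) by (intro powr_le_one_plus_power) auto
    then show "AE v in M. norm (\<bar>y v\<bar> powr q) \<le> norm (1 + y v ^ (2 * nat \<lceil>q\<rceil>))"
      by (intro AE_I2) (auto simp: power_even_abs intro: order_trans[OF _ abs_ge_self])
  qed (use assms(2) in measurable)
qed

locale moment_vector = finite_measure M for M :: "'a measure" +
  fixes X :: "'a \<Rightarrow> real ^ 'n"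
  assumes X_measurable [measurable]: "X \<in> borel_measurable M"
    and integrable_monom: "\<And>\<alpha>. integrable M (\<lambda>v. monom_at (X v) \<alpha>)"
begin

definition exp_monom :: "(real ^ 'n) \<Rightarrow> ('n \<Rightarrow> nat) \<Rightarrow> 'a \<Rightarrow> complex" where
  "exp_monom l \<alpha> = (\<lambda>v. complex_of_real (monom_at (X v) \<alpha>) * iexp (l \<bullet> X v))"

lemma exp_monom_measurable [measurable]: "exp_monom l \<alpha> \<in> borel_measurable M"
  unfolding exp_monom_def by measurable

lemma integrable_exp_monom_powr: "q > 0 \<Longrightarrow> integrable M (\<lambda>v. norm (exp_monom l \<alpha> v) powr q)"
  using integrable_powr_of_even_powers[OF finite_measure_axioms, of "\<lambda>v. monom_at (X v) \<alpha>" q]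
  by (simp add: exp_monom_def norm_mult monom_at_power integrable_monom)

lemma exp_monom_lspace: "p > 0 \<Longrightarrow> exp_monom l \<alpha> \<in> lspace p M"
  by (simp add: lspace_def integrable_exp_monom_powr)

text \<open>Induction on the set \<open>J\<close> of coordinates in which the frequency may differ
  from \<open>l0\<close>. The claim is carried for all exponents at once, because treating a new
  coordinate by \<open>exp_mult_mem\<close> presupposes that all its powers times the old function
  lie in \<open>V\<close>.\<close>

lemma exp_monom_mem:
  assumes p: "p \<ge> 1" and V: "closed_subspace p M V"
    and carl: "\<And>n. carleman (\<lambda>k. LINT v|M. (X v $ n) ^ k)"
    and base: "\<And>\<alpha>. exp_monom l0 \<alpha> \<in> V"
  shows "exp_monom l \<alpha> \<in> V"
proof -
  have "exp_monom l \<alpha> \<in> V" if "finite J" "\<And>i. i \<notin> J \<Longrightarrow> l $ i = l0 $ i" for J l \<alpha>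
    using that
  proof (induction J arbitrary: l \<alpha> rule: finite_induct)
    case empty
    then have "l = l0" by (simp add: vec_eq_iff)
    then show ?case using base by simp
  next
    case (insert j J)
    define t where "t = l $ j - l0 $ j"
    \<comment> \<open>In coordinate \<open>j\<close> this frequency agrees with \<open>l0\<close>
      again, so the induction hypothesis covers it.\<close>
    define l' where "l' = l - axis j t"
    have l': "exp_monom l' \<beta> \<in> V" for \<beta>
      by (rule insert.IH) (use insert.prems in \<open>auto simp: l'_def t_def axis_def\<close>)
    have "(\<lambda>v. iexp (t * (X v $ j)) * exp_monom l' \<alpha> v) \<in> V"
    proof (rule exp_mult_mem[OF finite_measure_axioms p V _ _ carl])
      show "integrable M (\<lambda>v. (X v $ j) ^ k)" for k
        using integrable_monom[of "\<lambda>i. if i = j then k else 0"] by (simp add: monom_at_single)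
      show "(\<lambda>v. complex_of_real ((X v $ j) ^ k) * exp_monom l' \<alpha> v) \<in> V" for k
        using l'[of "\<lambda>i. (if i = j then k else 0) + \<alpha> i"]
        by (simp add: exp_monom_def monom_at_add monom_at_single mult.assoc)
      show "integrable M (\<lambda>v. norm (exp_monom l' \<alpha> v) powr (2 * p))"
        using p by (intro integrable_exp_monom_powr) auto
    qed (auto intro: measurable_compose[OF X_measurable borel_measurable_nth])
    moreover have "iexp (t * (X v $ j)) * exp_monom l' \<alpha> v = exp_monom l \<alpha> v" for v
    proof -
      have "l \<bullet> X v = t * (X v $ j) + l' \<bullet> X v"
        by (simp add: l'_def inner_diff_left inner_axis')
      then show ?thesis by (simp add: exp_monom_def exp_add distrib_left mult_ac)
    qed
    ultimately show ?case by simp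
  qed
  from this[of UNIV] show ?thesis by simp
qed

end

section \<open>From exponentials to indicators\<close>

text \<open>The coordinates of \<open>X\<close> may be unbounded and then are not multipliers. This
  limit recovers their measurability from bounded functions.\<close>

lemma scaled_sin_tendsto: "(\<lambda>j. real (Suc j) * sin (1 / real (Suc j) * y)) \<longlonglongrightarrow> y"
proof (cases "y = 0")
  case False
  have "((\<lambda>x. sin x / x) \<longlongrightarrow> 1) (at (0::real))"
    using DERIV_sin[of 0] by (simp add: DERIV_def)
  moreover have "filterlim (\<lambda>j. y * (1 / real (Suc j))) (at 0) sequentially"
  proof -
    have "(\<lambda>j. y * (1 / real (Suc j))) \<longlonglongrightarrow> y * 0"
      using LIMSEQ_inverse_real_of_nat by (intro tendsto_intros) (simp add: inverse_eq_divide)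
    then show ?thesis using False by (simp add: filterlim_at)
  qed
  ultimately have "(\<lambda>j. sin (y * (1 / real (Suc j))) / (y * (1 / real (Suc j)))) \<longlonglongrightarrow> 1"
    by (rule filterlim_compose)
  then have "(\<lambda>j. y * (sin (y * (1 / real (Suc j))) / (y * (1 / real (Suc j))))) \<longlonglongrightarrow> y * 1"
    by (intro tendsto_intros)
  moreover have "y * (sin (y * (1 / real (Suc j))) / (y * (1 / real (Suc j)))) = real (Suc j) * sin (1 / real (Suc j) * y)" for j
    using False by (simp add: mult.commute del: of_nat_Suc)
  ultimately show ?thesis by simp
qed simp

locale exp_subspace = finite_measure M for M :: "'a measure" +
  fixes X :: "'a \<Rightarrow> real ^ 'n" and p :: real and V :: "('a \<Rightarrow> complex) set"
  assumes X_measurable [measurable]: "X \<in> borel_measurable M"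
    and p: "p \<ge> 1" and V: "closed_subspace p M V"
    and exp_mem: "\<And>l. (\<lambda>v. iexp (l \<bullet> X v)) \<in> V"
begin

text \<open>Asking for all frequencies instead of \<open>h \<in> V\<close> alone makes the set
  stable under multiplication by exponentials, which thereby become multipliers.\<close>

definition exp_stable :: "('a \<Rightarrow> complex) set" where
  "exp_stable = {h \<in> borel_measurable M. (\<exists>K. \<forall>v. norm (h v) \<le> K) \<and> (\<forall>l. (\<lambda>v. h v * iexp (l \<bullet> X v)) \<in> V)}"

text \<open>
  Products of bounded functions in \<open>V\<close> need not lie in \<open>V\<close>; the multipliers of \<open>exp_stable\<close>
  are an algebra by construction.
\<close>

definition multipliers :: "('a \<Rightarrow> complex) set" where
  "multipliers = {k \<in> borel_measurable M. (\<exists>K. \<forall>v. norm (k v) \<le> K) \<and> (\<forall>h\<in>exp_stable. (\<lambda>v. k v * h v) \<in> exp_stable)}"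

lemma multipliers_measurable: "k \<in> multipliers \<Longrightarrow> k \<in> borel_measurable M"
  by (simp add: multipliers_def)

lemma multipliers_bounded: "k \<in> multipliers \<Longrightarrow> \<exists>K. \<forall>v. norm (k v) \<le> K"
  by (simp add: multipliers_def)

lemma exp_stable_add: "h \<in> exp_stable \<Longrightarrow> k \<in> exp_stable \<Longrightarrow> (\<lambda>v. h v + k v) \<in> exp_stable"
proof -
  assume h: "h \<in> exp_stable" and k: "k \<in> exp_stable"
  obtain K L where "\<And>v. norm (h v) \<le> K" "\<And>v. norm (k v) \<le> L"
    using h k by (auto simp: exp_stable_def)
  then have "norm (h v + k v) \<le> K + L" for v by (intro norm_triangle_mono)
  moreover have "(\<lambda>v. (h v + k v) * iexp (l \<bullet> X v)) \<in> V" for l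
    unfolding distrib_right using h k by (intro closed_subspace_add[OF V]) (auto simp: exp_stable_def)
  ultimately show ?thesis using h k by (auto simp: exp_stable_def)
qed

lemma exp_stable_cmult: "h \<in> exp_stable \<Longrightarrow> (\<lambda>v. c * h v) \<in> exp_stable"
proof -
  assume h: "h \<in> exp_stable"
  obtain K where "\<And>v. norm (h v) \<le> K" using h by (auto simp: exp_stable_def)
  then have "norm (c * h v) \<le> norm c * K" for v by (simp add: norm_mult mult_left_mono)
  moreover have "(\<lambda>v. c * h v * iexp (l \<bullet> X v)) \<in> V" for l
    unfolding mult.assoc using h by (intro closed_subspace_cmult[OF V]) (auto simp: exp_stable_def)
  ultimately show ?thesis using h by (auto simp: exp_stable_def)
qed

lemma multipliers_add: "h \<in> multipliers \<Longrightarrow> k \<in> multipliers \<Longrightarrow> (\<lambda>v. h v + k v) \<in> multipliers"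
proof -
  assume h: "h \<in> multipliers" and k: "k \<in> multipliers"
  obtain K L where "\<And>v. norm (h v) \<le> K" "\<And>v. norm (k v) \<le> L"
    using h k by (auto simp: multipliers_def)
  then have "norm (h v + k v) \<le> K + L" for v by (intro norm_triangle_mono)
  then show ?thesis using h k by (auto simp: multipliers_def distrib_right intro!: exp_stable_add)
qed

lemma multipliers_mult: "h \<in> multipliers \<Longrightarrow> k \<in> multipliers \<Longrightarrow> (\<lambda>v. h v * k v) \<in> multipliers"
proof -
  assume h: "h \<in> multipliers" and k: "k \<in> multipliers"
  obtain K L where "\<And>v. norm (h v) \<le> K" "\<And>v. norm (k v) \<le> L"
    using h k by (auto simp: multipliers_def)
  then have "norm (h v * k v) \<le> K * L" for v
    unfolding norm_mult by (meson mult_mono norm_ge_zero order_trans)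
  then show ?thesis using h k by (auto simp: multipliers_def mult.assoc)
qed

lemma multipliers_const: "(\<lambda>v. c) \<in> multipliers"
  by (auto simp: multipliers_def intro!: exp_stable_cmult)

lemma multipliers_exp: "(\<lambda>v. iexp (l \<bullet> X v)) \<in> multipliers"
proof -
  have "(\<lambda>v. iexp (l \<bullet> X v) * h v) \<in> exp_stable" if "h \<in> exp_stable" for h
  proof -
    have "(\<lambda>v. iexp (l \<bullet> X v) * h v * iexp (m \<bullet> X v)) = (\<lambda>v. h v * iexp ((l + m) \<bullet> X v))" for m
      by (simp add: inner_add_left distrib_left exp_add mult_ac)
    moreover have "(\<lambda>v. h v * iexp ((l + m) \<bullet> X v)) \<in> V" for m
      using that unfolding exp_stable_def by blast
    moreover have "(\<lambda>v. iexp (l \<bullet> X v) * h v) \<in> borel_measurable M"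
      using that by (auto simp: exp_stable_def intro!: borel_measurable_times)
    ultimately show ?thesis using that by (simp add: exp_stable_def norm_mult)
  qed
  then show ?thesis by (auto simp: multipliers_def)
qed

lemma exp_stable_limit:
  assumes h: "\<And>i. h i \<in> exp_stable" and le: "\<And>i v. norm (h i v) \<le> K"
    and lim: "\<And>v. (\<lambda>i. h i v) \<longlonglongrightarrow> k v"
  shows "k \<in> exp_stable"
proof -
  have hm: "h i \<in> borel_measurable M" for i using h[of i] by (simp add: exp_stable_def)
  have km: "k \<in> borel_measurable M" by (rule borel_measurable_LIMSEQ_metric[OF hm lim])
  have "norm (k v) \<le> K" for v by (rule tendsto_upperbound[OF tendsto_norm[OF lim]]) (use le in auto)
  moreover have "(\<lambda>v. k v * iexp (l \<bullet> X v)) \<in> V" for l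
  proof (rule closed_subspace_dominated_limit[OF p V])
    show "(\<lambda>v. complex_of_real K) \<in> lspace p M"
      by (rule lspace_bounded[OF finite_measure_axioms, of _ _ "\<bar>K\<bar>"]) (use p in auto)
    show "(\<lambda>v. h i v * iexp (l \<bullet> X v)) \<in> V" for i using h[of i] by (simp add: exp_stable_def)
    show "AE v in M. (\<lambda>i. h i v * iexp (l \<bullet> X v)) \<longlonglongrightarrow> k v * iexp (l \<bullet> X v)"
      by (intro AE_I2 tendsto_intros lim)
    show "AE v in M. norm (h i v * iexp (l \<bullet> X v)) \<le> norm (complex_of_real K)" for i
      using le by (intro AE_I2) (auto simp: norm_mult intro: order_trans[OF _ abs_ge_self])
  qed (use km in measurable)
  ultimately show ?thesis using km by (auto simp: exp_stable_def)
qed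

lemma multipliers_limit:
  assumes h: "\<And>i. h i \<in> multipliers" and le: "\<And>i v. norm (h i v) \<le> K"
    and lim: "\<And>v. (\<lambda>i. h i v) \<longlonglongrightarrow> k v"
  shows "k \<in> multipliers"
proof -
  have hm: "h i \<in> borel_measurable M" for i using h[of i] by (simp add: multipliers_def)
  have km: "k \<in> borel_measurable M" by (rule borel_measurable_LIMSEQ_metric[OF hm lim])
  have "norm (k v) \<le> K" for v by (rule tendsto_upperbound[OF tendsto_norm[OF lim]]) (use le in auto)
  moreover have "(\<lambda>v. k v * g v) \<in> exp_stable" if g: "g \<in> exp_stable" for g
  proof -
    obtain L where L: "\<And>v. norm (g v) \<le> L" using g by (auto simp: exp_stable_def)
    show ?thesis
    proof (rule exp_stable_limit)
      show "(\<lambda>v. h i v * g v) \<in> exp_stable" for i using h[of i] g by (simp add: multipliers_def)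
      show "norm (h i v * g v) \<le> K * L" for i v
        unfolding norm_mult using le[of i v] L[of v] by (meson mult_mono norm_ge_zero order_trans)
      show "(\<lambda>i. h i v * g v) \<longlonglongrightarrow> k v * g v" for v by (intro tendsto_intros lim)
    qed
  qed
  ultimately show ?thesis using km by (auto simp: multipliers_def)
qed

text \<open>The constant 1 lies in \<open>exp_stable\<close> because the exponentials lie in
  \<open>V\<close>. A multiplier applied to it is the multiplier itself, and frequency 0 puts that
  into \<open>V\<close>.\<close>

lemma multipliers_subset: "multipliers \<subseteq> V"
proof
  fix k assume "k \<in> multipliers"
  moreover have "(\<lambda>v. 1) \<in> exp_stable" using exp_mem by (auto simp: exp_stable_def)
  ultimately have "(\<lambda>v. k v * 1) \<in> exp_stable" by (auto simp: multipliers_def)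
  then have "(\<lambda>v. k v * 1 * iexp (0 \<bullet> X v)) \<in> V" unfolding exp_stable_def by blast
  then show "k \<in> V" by simp
qed

abbreviation real_multiplier :: "('a \<Rightarrow> real) \<Rightarrow> bool" where
  "real_multiplier u \<equiv> (\<lambda>v. complex_of_real (u v)) \<in> multipliers"

lemma real_multiplier_polynomial:
  fixes g :: "real \<Rightarrow> real"
  assumes "real_polynomial_function g" "real_multiplier u"
  shows "real_multiplier (\<lambda>v. g (u v))"
  using assms(1)
proof (induction g rule: real_polynomial_function.induct)
  case (linear g)
  then obtain c where "g = (\<lambda>x. x * c)" by (auto simp: real_bounded_linear)
  then show ?case using multipliers_mult[OF assms(2) multipliers_const[of c]] by simp
next
  case (const c)
  then show ?case by (rule multipliers_const)
next
  case (add f g)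
  then show ?case using multipliers_add by fastforce
next
  case (mult f g)
  then show ?case using multipliers_mult by fastforce
qed

text \<open>The values of \<open>u\<close> lie in a compact interval, where \<open>\<phi>\<close> is
  a uniform limit of polynomials; polynomials in \<open>u\<close> are multipliers, and bounded
  limits remain so.\<close>

lemma real_multiplier_continuous:
  fixes \<phi> :: "real \<Rightarrow> real"
  assumes "real_multiplier u" "continuous_on UNIV \<phi>"
  shows "real_multiplier (\<lambda>v. \<phi> (u v))"
proof -
  obtain K where K: "\<And>v. \<bar>u v\<bar> \<le> K" using multipliers_bounded[OF assms(1)] by auto
  have cont: "continuous_on {-K..K} \<phi>" using assms(2) continuous_on_subset by blast
  have "\<exists>g. real_polynomial_function g \<and> (\<forall>x\<in>{-K..K}. \<bar>\<phi> x - g x\<bar> < 1 / real (Suc i))" for i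
    using Stone_Weierstrass_real_polynomial_function[OF compact_Icc cont, of "1 / real (Suc i)"]
    by (metis of_nat_0_less_iff zero_less_Suc zero_less_divide_1_iff)
  then obtain g where g: "\<And>i. real_polynomial_function (g i)"
    and close: "\<And>i x. x \<in> {-K..K} \<Longrightarrow> \<bar>\<phi> x - g i x\<bar> < 1 / real (Suc i)"
    by metis
  have uK: "u v \<in> {-K..K}" for v using K[of v] by auto
  have "bounded (\<phi> ` {-K..K})" by (intro compact_imp_bounded compact_continuous_image cont compact_Icc)
  then obtain L where L: "\<And>x. x \<in> {-K..K} \<Longrightarrow> \<bar>\<phi> x\<bar> \<le> L" unfolding bounded_iff by (metis imageI real_norm_def)
  show ?thesis
  proof (rule multipliers_limit)
    show "real_multiplier (\<lambda>v. g i (u v))" for i by (rule real_multiplier_polynomial[OF g assms(1)])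
    show "norm (complex_of_real (g i (u v))) \<le> L + 1" for i v
    proof -
      have "1 / real (Suc i) \<le> 1" by simp
      then show ?thesis using close[OF uK, of v i] L[OF uK, of v] unfolding norm_of_real by linarith
    qed
    show "(\<lambda>i. complex_of_real (g i (u v))) \<longlonglongrightarrow> complex_of_real (\<phi> (u v))" for v
    proof (rule tendsto_of_real, rule metric_LIMSEQ_I)
      fix e :: real assume "e > 0"
      then obtain N where N: "inverse (real (Suc N)) < e" using reals_Archimedean by blast
      have "dist (g i (u v)) (\<phi> (u v)) < e" if "i \<ge> N" for i
      proof -
        have "1 / real (Suc i) \<le> inverse (real (Suc N))" using that by (simp add: field_simps)
        then show ?thesis using close[OF uK, of v i] N by (simp add: dist_real_def abs_minus_commute)
      qed
      then show "\<exists>N. \<forall>i\<ge>N. dist (g i (u v)) (\<phi> (u v)) < e" by blast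
    qed
  qed
qed

text \<open>Bounds are imposed at every point of the type, while membership in \<open>V\<close> sees
  only \<open>space M\<close>. The difference matters for complements, which are taken within
  \<open>space M\<close>.\<close>

lemma exp_stable_cong:
  assumes "h \<in> exp_stable" "k \<in> borel_measurable M" "\<And>v. norm (k v) \<le> K" "\<And>v. v \<in> space M \<Longrightarrow> k v = h v"
  shows "k \<in> exp_stable"
proof -
  have "(\<lambda>v. k v * iexp (l \<bullet> X v)) \<in> V" for l
  proof (rule closed_subspace_AE_cong[OF p V])
    show "(\<lambda>v. h v * iexp (l \<bullet> X v)) \<in> V" using assms(1) by (simp add: exp_stable_def)
  qed (use assms in auto)
  then show ?thesis using assms by (auto simp: exp_stable_def)
qed

lemma multipliers_cong:
  assumes h: "h \<in> multipliers" and k: "k \<in> borel_measurable M" "\<And>v. norm (k v) \<le> K"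
    and eq: "\<And>v. v \<in> space M \<Longrightarrow> k v = h v"
  shows "k \<in> multipliers"
proof -
  have "(\<lambda>v. k v * g v) \<in> exp_stable" if g: "g \<in> exp_stable" for g
  proof -
    obtain L where L: "\<And>v. norm (g v) \<le> L" using g by (auto simp: exp_stable_def)
    show ?thesis
    proof (rule exp_stable_cong)
      show "(\<lambda>v. h v * g v) \<in> exp_stable" using h g by (simp add: multipliers_def)
      show "norm (k v * g v) \<le> K * L" for v
        unfolding norm_mult using k(2)[of v] L[of v] by (meson mult_mono norm_ge_zero order_trans)
      show "(\<lambda>v. k v * g v) \<in> borel_measurable M" using k(1) g by (auto simp: exp_stable_def intro!: borel_measurable_times)
    qed (simp add: eq)
  qed
  then show ?thesis using k by (auto simp: multipliers_def)
qed

section \<open>The sigma-algebra of sets whose indicators are multipliers\<close>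

definition multiplier_sets :: "'a set set" where
  "multiplier_sets = {A \<in> sets M. real_multiplier (indicator A)}"

lemma multiplier_setsI:
  assumes "A \<in> sets M" "h \<in> multipliers" "\<And>v. v \<in> space M \<Longrightarrow> complex_of_real (indicator A v) = h v"
  shows "A \<in> multiplier_sets"
proof -
  have "(\<lambda>v. complex_of_real (indicator A v)) \<in> borel_measurable M" using assms(1) by measurable
  then have "(\<lambda>v. complex_of_real (indicator A v)) \<in> multipliers"
    by (rule multipliers_cong[OF assms(2), where K = 1]) (use assms(3) in \<open>auto simp: indicator_def\<close>)
  then show ?thesis using assms(1) by (simp add: multiplier_sets_def)
qed

text \<open>The indicator is the pointwise limit of continuous ramps of slope \<open>i\<close>
  starting at \<open>c\<close>. They are 0 at \<open>c\<close> itself, which gives the strict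
  inequality.\<close>

lemma multiplier_sets_greater:
  assumes u: "real_multiplier u"
  shows "{v \<in> space M. c < u v} \<in> multiplier_sets"
proof (rule multiplier_setsI)
  have um [measurable]: "u \<in> borel_measurable M"
    using measurable_compose[OF multipliers_measurable[OF u] borel_measurable_Re] by simp
  show "{v \<in> space M. c < u v} \<in> sets M" by measurable
  show "(\<lambda>v. complex_of_real (indicator {v. c < u v} v)) \<in> multipliers"
  proof (rule multipliers_limit)
    show "real_multiplier (\<lambda>v. min 1 (max 0 (real i * (u v - c))))" for i
      by (rule real_multiplier_continuous[OF u, of "\<lambda>x. min 1 (max 0 (real i * (x - c)))"])
        (intro continuous_intros)
    show "norm (complex_of_real (min 1 (max 0 (real i * (u v - c))))) \<le> 1" for i v by simp
    show "(\<lambda>i. complex_of_real (min 1 (max 0 (real i * (u v - c)))))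
        \<longlonglongrightarrow> complex_of_real (indicator {v. c < u v} v)" for v
    proof (intro tendsto_of_real)
      show "(\<lambda>i. min 1 (max 0 (real i * (u v - c)))) \<longlonglongrightarrow> indicator {v. c < u v} v"
      proof (cases "c < u v")
        case True
        then have "eventually (\<lambda>i. real i \<ge> 1 / (u v - c)) sequentially"
          using filterlim_real_sequentially by (auto simp: filterlim_at_top)
        then have "eventually (\<lambda>i. min 1 (max 0 (real i * (u v - c))) = indicator {v. c < u v} v) sequentially"
          by eventually_elim (use True in \<open>auto simp: divide_le_eq\<close>)
        then show ?thesis by (rule tendsto_eventually)
      next
        case False
        then have "min 1 (max 0 (real i * (u v - c))) = 0" for i
          by (simp add: mult_nonneg_nonpos max_absorb1)
        then show ?thesis using False by simp
      qed
    qed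
  qed
qed (auto simp: indicator_def)

lemma sigma_algebra_multiplier_sets: "sigma_algebra (space M) multiplier_sets"
  unfolding sigma_algebra_iff2
proof (intro conjI ballI allI impI)
  show "multiplier_sets \<subseteq> Pow (space M)" using sets.space_closed by (auto simp: multiplier_sets_def)
  show "{} \<in> multiplier_sets" using multipliers_const[of 0] by (simp add: multiplier_sets_def)
next
  fix A assume A: "A \<in> multiplier_sets"
  show "space M - A \<in> multiplier_sets"
  proof (rule multiplier_setsI)
    show "(\<lambda>v. 1 + (- 1) * complex_of_real (indicator A v)) \<in> multipliers"
      using A by (intro multipliers_add multipliers_mult multipliers_const) (simp add: multiplier_sets_def)
  qed (use A in \<open>auto simp: multiplier_sets_def indicator_def\<close>)
next
  fix A :: "nat \<Rightarrow> 'a set" assume A: "range A \<subseteq> multiplier_sets"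
  \<comment> \<open>\<open>h n\<close> is the indicator of the complement of the union of the first
    \<open>n\<close> sets; these functions are bounded by 1 and converge to the indicator of the
    complement of the whole union.\<close>
  define h where "h = (\<lambda>n v. \<Prod>i<n. 1 + (- 1) * complex_of_real (indicator (A i) v))"
  have h: "h n \<in> multipliers" for n
  proof (induction n)
    case 0
    then show ?case using multipliers_const[of 1] by (simp add: h_def)
  next
    case (Suc n)
    have "(\<lambda>v. h n v * (1 + (- 1) * complex_of_real (indicator (A n) v))) \<in> multipliers"
      using A by (intro multipliers_mult Suc.IH multipliers_add multipliers_const) (auto simp: multiplier_sets_def)
    then show ?case by (simp add: h_def)
  qed
  have norm_h: "norm (h n v) \<le> 1" for n v
    unfolding h_def prod_norm[symmetric] by (intro prod_le_1) (auto simp: indicator_def)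
  have lim: "(\<lambda>n. h n v) \<longlonglongrightarrow> (if v \<in> (\<Union>i. A i) then 0 else 1)" for v
  proof (cases "v \<in> (\<Union>i. A i)")
    case True
    then obtain j where j: "v \<in> A j" by auto
    have "h n v = 0" if "n > j" for n
      unfolding h_def using that j by (intro prod_zero) (auto intro!: bexI[of _ j])
    then have "eventually (\<lambda>n. h n v = 0) sequentially"
      unfolding eventually_sequentially by (intro exI[of _ "Suc j"]) auto
    then show ?thesis using True tendsto_eventually by auto
  next
    case False
    then have "h n v = 1" for n by (simp add: h_def)
    then show ?thesis using False by auto
  qed
  have "(\<lambda>v. if v \<in> (\<Union>i. A i) then 0 else 1) \<in> multipliers"
    by (rule multipliers_limit[OF h norm_h lim])
  then have "(\<lambda>v. 1 + (- 1) * (if v \<in> (\<Union>i. A i) then 0 else 1)) \<in> multipliers"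
    by (intro multipliers_add multipliers_mult multipliers_const)
  then show "(\<Union>i. A i) \<in> multiplier_sets"
  proof (rule multiplier_setsI[rotated])
    show "(\<Union>i. A i) \<in> sets M" using A by (intro sets.countable_UN) (auto simp: multiplier_sets_def)
  qed (auto simp: indicator_def)
qed

lemma real_multiplier_sin: "real_multiplier (\<lambda>v. sin (t * (X v $ n)))"
proof -
  have "(\<lambda>v. (1 / (2 * \<i>)) * (iexp (axis n t \<bullet> X v) + (- 1) * iexp (axis n (- t) \<bullet> X v))) \<in> multipliers"
    by (intro multipliers_mult multipliers_add multipliers_const multipliers_exp)
  moreover have "(1 / (2 * \<i>)) * (iexp (axis n t \<bullet> X v) + (- 1) * iexp (axis n (- t) \<bullet> X v))
      = complex_of_real (sin (t * (X v $ n)))" for v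
    by (simp add: inner_axis' sin_exp_eq flip: sin_of_real)
  ultimately show ?thesis by simp
qed

lemma vimage_mem_multiplier_sets:
  assumes "C \<in> sets borel"
  shows "X -` C \<inter> space M \<in> multiplier_sets"
proof -
  interpret sigma_algebra "space M" multiplier_sets by (rule sigma_algebra_multiplier_sets)
  \<comment> \<open>The zero measure merely carries the sigma-algebra, so that facts on measurable
    functions apply to it.\<close>
  define N where "N = measure_of (space M) multiplier_sets (\<lambda>_. 0)"
  have N: "sets N = multiplier_sets" "space N = space M"
    unfolding N_def by (simp_all add: space_closed)
  have "(\<lambda>v. X v $ n) \<in> borel_measurable N" for n
  proof (rule borel_measurable_LIMSEQ_real[OF scaled_sin_tendsto])
    fix j
    have "(\<lambda>v. sin (1 / real (Suc j) * (X v $ n))) \<in> borel_measurable N"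
      unfolding borel_measurable_iff_greater N
      using multiplier_sets_greater[OF real_multiplier_sin[of "1 / real (Suc j)" n]] by simp
    then show "(\<lambda>v. real (Suc j) * sin (1 / real (Suc j) * (X v $ n))) \<in> borel_measurable N"
      by measurable
  qed
  then have "X \<in> borel_measurable N"
    by (subst borel_measurable_euclidean_space) (auto simp: Basis_vec_def inner_axis)
  from measurable_sets[OF this assms] show ?thesis by (simp add: N)
qed

lemma indicator_vimage_mem:
  assumes "C \<in> sets borel"
  shows "(\<lambda>v. complex_of_real (indicator (X -` C \<inter> space M) v)) \<in> V"
  using vimage_mem_multiplier_sets[OF assms] multipliers_subset by (auto simp: multiplier_sets_def)

end

section \<open>Finite linear groups\<close>

locale linear_group =
  fixes G :: "(real ^ 'm ^ 'm) set"
  assumes finite_linear_group: "finite_linear_group G"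
begin

lemma finite_G: "finite G" and one_mem: "mat 1 \<in> G"
  and mult_mem: "g \<in> G \<Longrightarrow> h \<in> G \<Longrightarrow> g ** h \<in> G"
  and inv_mem: "g \<in> G \<Longrightarrow> matrix_inv g \<in> G"
  and invertible_mem: "g \<in> G \<Longrightarrow> invertible g"
  using finite_linear_group by (auto simp: finite_linear_group_def)

lemma matrix_inv:
  assumes "g \<in> G"
  shows "g ** matrix_inv g = mat 1" "matrix_inv g ** g = mat 1"
  using someI_ex[OF invertible_mem[OF assms, unfolded invertible_def]] by (simp_all add: matrix_inv_def)

lemma inv_act [simp]: "g \<in> G \<Longrightarrow> matrix_inv g *v (g *v v) = v"
  using matrix_inv by (simp add: matrix_vector_mul_assoc)

lemma act_inv [simp]: "g \<in> G \<Longrightarrow> g *v (matrix_inv g *v v) = v"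
  using matrix_inv by (simp add: matrix_vector_mul_assoc)

lemma inv_inv:
  assumes "g \<in> G"
  shows "matrix_inv (matrix_inv g) = g"
proof -
  have "matrix_inv (matrix_inv g) *v v = g *v v" for v
    using inv_act[OF inv_mem[OF assms], of "g *v v"] assms by simp
  then show ?thesis by (simp add: matrix_eq)
qed

lemma invariant_fun_iff: "invariant_fun G h \<longleftrightarrow> (\<forall>g\<in>G. \<forall>v. h (g *v v) = h v)"
  unfolding invariant_fun_def using inv_mem inv_inv by metis

text \<open>Right translation by \<open>k\<close> is injective on the finite set \<open>G\<close>,
  hence permutes it.\<close>

lemma sum_act:
  fixes F :: "real ^ 'm \<Rightarrow> 'b::comm_monoid_add"
  assumes "k \<in> G"
  shows "(\<Sum>g\<in>G. F (g *v (k *v v))) = (\<Sum>g\<in>G. F (g *v v))"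
proof -
  have "inj_on (\<lambda>g. g ** k) G"
  proof (rule inj_onI)
    fix g h assume "g ** k = h ** k"
    then have "g ** (k ** matrix_inv k) = h ** (k ** matrix_inv k)" by (simp only: matrix_mul_assoc)
    then show "g = h" using matrix_inv[OF assms] by simp
  qed
  moreover have "(\<lambda>g. g ** k) ` G \<subseteq> G" using mult_mem assms by auto
  ultimately have "bij_betw (\<lambda>g. g ** k) G G"
    using endo_inj_surj[OF finite_G] by (simp add: bij_betw_def)
  then have "(\<Sum>g\<in>G. F ((g ** k) *v v)) = (\<Sum>g\<in>G. F (g *v v))"
    by (rule sum.reindex_bij_betw)
  then show ?thesis by (simp add: matrix_vector_mul_assoc)
qed

lemma invariant_fun_sum: "invariant_fun G (\<lambda>v. \<Sum>g\<in>G. F (g *v v) :: 'b::comm_monoid_add)"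
  by (simp add: invariant_fun_iff sum_act)

text \<open>
  The product of the squared distances to the orbit points detects the orbit of \<open>v\<close>, but it is
  invariant only after summation over the group.
\<close>

lemma orbit_separation:
  fixes f :: "real ^ 'm \<Rightarrow> real ^ 'n"
  assumes gen: "generates_invariants G f UNIV" and eq: "f v = f w"
  shows "\<exists>g\<in>G. w = g *v v"
proof -
  define d where "d = (\<lambda>x. \<Prod>g\<in>G. \<Sum>i\<in>UNIV. (x $ i - (g *v v) $ i)\<^sup>2)"
  have d_nonneg: "d x \<ge> 0" for x unfolding d_def by (intro prod_nonneg ballI sum_nonneg) auto
  have d_zero: "d x = 0 \<longleftrightarrow> (\<exists>g\<in>G. x = g *v v)" for x
    unfolding d_def using finite_G by (simp add: sum_nonneg_eq_0_iff vec_eq_iff)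
  define P where "P = (\<lambda>x. \<Sum>g\<in>G. d (g *v x))"
  have "real_polynomial_function (\<lambda>x. (g *v x) $ i)" for g :: "real ^ 'm ^ 'm" and i
    by (intro real_polynomial_function.intros(1) bounded_linear_compose[OF bounded_linear_vec_nth])
      (rule matrix_vector_mul_bounded_linear)
  then have "real_polynomial_function P"
    unfolding P_def d_def using finite_G
    by (intro real_polynomial_function_sum real_polynomial_function_prod
        real_polynomial_function_power real_polynomial_function_diff real_polynomial_function.intros(2)) auto
  moreover have "invariant_fun G P" unfolding P_def by (rule invariant_fun_sum)
  ultimately obtain q where "P = (\<lambda>v. q (\<chi> n. if n \<in> UNIV then f v $ n else 0))"
    using gen unfolding generates_invariants_def real_invariant_polys_def by blast
  then have "P v = P w" using eq by simp
  moreover have "d (g *v v) = 0" if "g \<in> G" for g using that d_zero by blast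
  then have "P v = 0" by (simp add: P_def)
  ultimately have "P w = 0" by simp
  \<comment> \<open>A sum of nonnegative terms vanishes only termwise; the term of the identity is
    \<open>d w\<close>.\<close>
  then have "d (mat 1 *v w) = 0"
    unfolding P_def using finite_G one_mem d_nonneg by (subst (asm) sum_nonneg_eq_0_iff) auto
  then show ?thesis by (simp add: d_zero)
qed

lemma measurable_act [measurable]:
  fixes g :: "real ^ 'm ^ 'm"
  shows "(\<lambda>v. g *v v) \<in> borel_measurable borel"
  by (rule borel_measurable_continuous_onI) (rule matrix_vector_mult_linear_continuous_on)

lemma measurable_act_sets:
  fixes g :: "real ^ 'm ^ 'm"
  assumes "sets P = sets borel"
  shows "(\<lambda>v. g *v v) \<in> measurable P P"
  using measurable_act by (simp add: measurable_cong_sets[OF assms assms])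

section \<open>Invariant Borel sets and invariant functions\<close>

definition invariant_sets :: "(real ^ 'm) set set" where
  "invariant_sets = {A \<in> sets borel. \<forall>g\<in>G. (\<lambda>v. g *v v) -` A = A}"

lemma sigma_algebra_invariant_sets: "sigma_algebra UNIV invariant_sets"
  unfolding sigma_algebra_iff2
proof (intro conjI ballI allI impI)
  fix A :: "nat \<Rightarrow> (real ^ 'm) set" assume A: "range A \<subseteq> invariant_sets"
  then have "(\<Union>i. A i) \<in> sets borel" by (intro sets.countable_UN) (auto simp: invariant_sets_def)
  moreover have "(\<lambda>v. g *v v) -` (\<Union>i. A i) = (\<Union>i. A i)" if "g \<in> G" for g
    unfolding vimage_UN using A that by (intro SUP_cong) (auto simp: invariant_sets_def)
  ultimately show "(\<Union>i. A i) \<in> invariant_sets" by (simp add: invariant_sets_def)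
qed (auto simp: invariant_sets_def vimage_Diff)

lemma indicator_invariant_mem:
  fixes f :: "real ^ 'm \<Rightarrow> real ^ 'n"
  assumes P: "finite_measure P" "sets P = sets borel"
    and f: "continuous_on UNIV f" "invariant_fun G f" "generates_invariants G f UNIV"
    and p: "p \<ge> 1" and V: "closed_subspace p P V"
    and mem: "\<And>C. C \<in> sets borel \<Longrightarrow> (\<lambda>v. complex_of_real (indicator (f -` C) v)) \<in> V"
    and A: "A \<in> invariant_sets"
  shows "(\<lambda>v. complex_of_real (indicator A v)) \<in> V"
proof (rule closed_subspace_closed[OF V])
  interpret finite_measure P by (rule P(1))
  have A_sets [measurable]: "A \<in> sets P" using A P(2) by (simp add: invariant_sets_def)
  have [measurable]: "(\<lambda>v. complex_of_real (indicator A v)) \<in> borel_measurable P" by measurable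
  show "(\<lambda>v. complex_of_real (indicator A v)) \<in> lspace p P"
    by (rule lspace_bounded[OF P(1), where K = 1]) (use p in \<open>auto simp: indicator_def\<close>)
  fix \<epsilon> :: real assume \<epsilon>: "\<epsilon> > 0"
  \<comment> \<open>The p-th power of the distance between the indicators of \<open>A\<close> and
    \<open>L\<close> is the measure of \<open>A - L\<close>.\<close>
  define e where "e = (\<epsilon> / 2) powr p"
  have e: "e > 0" using \<epsilon> by (simp add: e_def)
  have "\<exists>K. K \<subseteq> A \<and> compact K \<and> measure P A \<le> measure P K + e"
  proof (rule ccontr)
    assume "\<not> ?thesis"
    then have *: "measure P K + e \<le> measure P A" if "K \<subseteq> A" "compact K" for K
      using that by (meson linear)
    have "(SUP K \<in> {K. K \<subseteq> A \<and> compact K}. emeasure P K) \<le> ennreal (measure P A - e)"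
    proof (rule SUP_least)
      fix K assume "K \<in> {K. K \<subseteq> A \<and> compact K}"
      then show "emeasure P K \<le> ennreal (measure P A - e)"
        using *[of K] by (auto simp: emeasure_eq_measure intro!: ennreal_leI)
    qed
    moreover have "emeasure P A = (SUP K \<in> {K. K \<subseteq> A \<and> compact K}. emeasure P K)"
      using A_sets P(2) emeasure_finite by (intro inner_regular) auto
    ultimately have "ennreal (measure P A) \<le> ennreal (measure P A - e)"
      by (simp add: emeasure_eq_measure)
    moreover have "0 \<le> measure P A - e"
      using *[of "{}"] by simp
    ultimately show False using e by simp
  qed
  then obtain K where K: "K \<subseteq> A" "compact K" "measure P A \<le> measure P K + e" by blast
  define L where "L = (\<Union>g\<in>G. (\<lambda>v. g *v v) ` K)"
  have "compact L"
    unfolding L_def using finite_G K(2)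
    by (intro compact_UN compact_continuous_image linear_continuous_on matrix_vector_mul_bounded_linear) auto
  have KL: "K \<subseteq> L" using one_mem by (force simp: L_def)
  have LA: "L \<subseteq> A" using K(1) A by (auto simp: L_def invariant_sets_def)
  have "compact (f ` L)" using \<open>compact L\<close> f(1) by (intro compact_continuous_image) (auto intro: continuous_on_subset)
  then have fL: "f ` L \<in> sets borel" by (intro borel_closed compact_imp_closed)
  have "f -` (f ` L) = L"
  proof
    show "f -` f ` L \<subseteq> L"
    proof
      fix w assume "w \<in> f -` f ` L"
      then obtain g k where gk: "f (g *v k) = f w" "g \<in> G" "k \<in> K" by (auto simp: L_def)
      then obtain g' where "g' \<in> G" "w = g' *v (g *v k)" using orbit_separation[OF f(3)] by blast
      then have "w = (g' ** g) *v k" by (simp add: matrix_vector_mul_assoc)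
      then show "w \<in> L" using mult_mem \<open>g' \<in> G\<close> gk unfolding L_def by blast
    qed
  qed auto
  then have L_mem: "(\<lambda>v. complex_of_real (indicator L v)) \<in> V" using mem[OF fL] by simp
  have [measurable]: "L \<in> sets P" using \<open>compact L\<close> P(2) by (simp add: borel_compact)
  have "K \<in> sets P" using K(2) P(2) by (simp add: borel_compact)
  have "lnorm p P (\<lambda>v. complex_of_real (indicator A v) - complex_of_real (indicator L v)) \<le> \<epsilon> / 2"
  proof (rule lnorm_le)
    have "(LINT v|P. norm (complex_of_real (indicator A v) - complex_of_real (indicator L v)) powr p)
        = (LINT v|P. indicator (A - L) v)"
      using LA p by (intro Bochner_Integration.integral_cong) (auto simp: indicator_def)
    also have "\<dots> = measure P (A - L)" by simp
    also have "\<dots> = measure P A - measure P L" using LA by (intro finite_measure_Diff) auto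
    also have "\<dots> \<le> e"
      using K(3) finite_measure_mono[OF KL] by simp
    finally show "(LINT v|P. norm (complex_of_real (indicator A v) - complex_of_real (indicator L v)) powr p) \<le> (\<epsilon> / 2) powr p"
      by (simp add: e_def)
  qed (use p \<epsilon> in auto)
  then have "lnorm p P (\<lambda>v. complex_of_real (indicator A v) - complex_of_real (indicator L v)) < \<epsilon>"
    using \<epsilon> by linarith
  then show "\<exists>q\<in>V. lnorm p P (\<lambda>v. complex_of_real (indicator A v) - q v) < \<epsilon>"
    using L_mem by (intro bexI)
qed

text \<open>Invariance of \<open>h\<close> holds only almost everywhere. The average
  \<open>k\<close> over the group agrees with \<open>h\<close> almost everywhere and is invariant at
  every point, hence measurable for the invariant sets; its approximating simple functions are
  combinations of the given indicators.\<close>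

lemma Lp_invariant_mem:
  assumes P: "finite_measure P" "sets P = sets borel"
    and p: "p \<ge> 1" and V: "closed_subspace p P V"
    and mem: "\<And>A. A \<in> invariant_sets \<Longrightarrow> (\<lambda>v. complex_of_real (indicator A v)) \<in> V"
    and h: "h \<in> Lp_invariant G p P"
  shows "h \<in> V"
proof -
  have space_P: "space P = UNIV" using sets_eq_imp_space_eq[OF P(2)] by simp
  have hm [measurable]: "h \<in> borel_measurable P" and hi: "integrable P (\<lambda>v. norm (h v) powr p)"
    using h by (auto simp: Lp_invariant_def)
  have h_lspace: "h \<in> lspace p P" using hm hi by (simp add: lspace_def)
  have h_AE: "AE v in P. h (g *v v) = h v" if "g \<in> G" for g
    using h inv_mem[OF that] inv_inv[OF that] unfolding Lp_invariant_def by force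
  define k where "k = (\<lambda>v. (\<Sum>g\<in>G. h (g *v v)) / of_nat (card G))"
  have card: "card G \<noteq> 0" using finite_G one_mem by auto
  have k_inv: "k (g *v v) = k v" if "g \<in> G" for g v using that by (simp add: k_def sum_act)
  have km: "k \<in> borel_measurable P"
    unfolding k_def using measurable_compose[OF measurable_act_sets[OF P(2)] hm] by measurable
  have "AE v in P. \<forall>g\<in>G. h (g *v v) = h v" using h_AE finite_G by (intro AE_finite_allI)
  then have kh: "AE v in P. k v = h v"
    by eventually_elim (use card in \<open>simp add: k_def\<close>)
  interpret S: sigma_algebra UNIV invariant_sets by (rule sigma_algebra_invariant_sets)
  define N where "N = measure_of UNIV invariant_sets (\<lambda>_. 0)"
  have N: "sets N = invariant_sets" "space N = UNIV"
    unfolding N_def by (simp_all add: S.space_closed)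
  have "k \<in> borel_measurable N"
  proof (rule measurableI)
    fix C :: "complex set" assume "C \<in> sets borel"
    then have "k -` C \<in> sets borel" using measurable_sets[OF km] P(2) space_P by simp
    then show "k -` C \<inter> space N \<in> sets N"
      using k_inv by (simp add: N invariant_sets_def vimage_def)
  qed auto
  then obtain s where s: "\<And>i. simple_function N (s i)" "\<And>v. (\<lambda>i. s i v) \<longlonglongrightarrow> k v"
    "\<And>i v. norm (s i v) \<le> 2 * norm (k v)"
    using borel_measurable_implies_sequence_metric[of k N 0] by (auto simp: N)
  have s_mem: "s i \<in> V" for i
  proof -
    have fin: "finite (range (s i))" using simple_functionD(1)[OF s(1)] by (simp add: N)
    have "(\<lambda>v. \<Sum>y\<in>range (s i). y * complex_of_real (indicator (s i -` {y}) v)) \<in> V"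
    proof (intro closed_subspace_sum[OF V] closed_subspace_cmult[OF V] mem)
      show "s i -` {y} \<in> invariant_sets" for y
        using simple_functionD(2)[OF s(1), of i "{y}"] by (simp add: N)
    qed
    moreover have "(\<Sum>y\<in>range (s i). y * complex_of_real (indicator (s i -` {y}) v)) = s i v" for v
    proof -
      have "(\<Sum>y\<in>range (s i). y * complex_of_real (indicator (s i -` {y}) v))
          = (\<Sum>y\<in>range (s i). if y = s i v then y else 0)"
        by (intro sum.cong) (auto simp: indicator_def)
      then show ?thesis using fin by simp
    qed
    ultimately show ?thesis by simp
  qed
  have "k \<in> lspace p P"
  proof (rule lspace_dominated(1)[OF _ h_lspace km])
    show "AE v in P. norm (k v) \<le> norm (h v)" using kh by eventually_elim simp
  qed (use p in simp)
  then have "(\<lambda>v. 2 * k v) \<in> lspace p P" using p by (intro lspace_cmult) auto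
  then have "k \<in> V"
    by (rule closed_subspace_dominated_limit[OF p V _ _ km, where h = s])
      (use s s_mem in \<open>auto simp: norm_mult\<close>)
  then show ?thesis
    by (rule closed_subspace_AE_cong[OF p V]) (use kh hm in auto)
qed

end

section \<open>Polynomials and sums of measures\<close>

text \<open>Integrability passes to sums and multiples but not to products, so it cannot be proved
  by induction along \<open>real_polynomial_function\<close>. This description of polynomials
  generates them without products.\<close>

inductive_set monomial_span :: "(real ^ 'n \<Rightarrow> real) set" where
  monom: "(\<lambda>x. monom_at x \<alpha>) \<in> monomial_span"
| add: "q \<in> monomial_span \<Longrightarrow> r \<in> monomial_span \<Longrightarrow> (\<lambda>x. q x + r x) \<in> monomial_span"
| cmult: "q \<in> monomial_span \<Longrightarrow> (\<lambda>x. c * q x) \<in> monomial_span"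

lemma monomial_span_mult:
  assumes "q \<in> monomial_span" "r \<in> monomial_span"
  shows "(\<lambda>x. q x * r x) \<in> monomial_span"
  using assms(1)
proof (induction q rule: monomial_span.induct)
  case (monom \<alpha>)
  show ?case using assms(2)
  proof (induction r rule: monomial_span.induct)
    case (monom \<beta>)
    then show ?case using monomial_span.monom[of "\<lambda>i. \<alpha> i + \<beta> i"] by (simp add: monom_at_add)
  next
    case (add q r)
    then show ?case using monomial_span.add by (fastforce simp: distrib_left)
  next
    case (cmult q c)
    then show ?case using monomial_span.cmult[of _ c] by (fastforce simp: mult.left_commute)
  qed
next
  case (add q r)
  then show ?case using monomial_span.add by (fastforce simp: distrib_right)
next
  case (cmult q c)
  then show ?case using monomial_span.cmult[of _ c] by (fastforce simp: mult.assoc)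
qed

lemma real_polynomial_function_monomial_span:
  fixes q :: "real ^ 'n \<Rightarrow> real"
  assumes "real_polynomial_function q"
  shows "q \<in> monomial_span"
  using assms
proof (induction q rule: real_polynomial_function.induct)
  case (linear q)
  interpret bounded_linear q by fact
  have coord: "(\<lambda>x. x $ i * q (axis i 1)) \<in> monomial_span" for i
    using monomial_span.cmult[OF monomial_span.monom[of "\<lambda>j. if j = i then 1 else 0"], of "q (axis i 1)"]
    by (simp add: monom_at_single mult.commute)
  have zero: "(\<lambda>x. 0) \<in> monomial_span"
    using monomial_span.cmult[OF monomial_span.monom, of 0] by simp
  have "(\<lambda>x. \<Sum>i\<in>I. x $ i * q (axis i 1)) \<in> monomial_span" for I :: "'n set"
    by (induction I rule: infinite_finite_induct) (auto simp: zero intro: monomial_span.add coord)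
  moreover have "q = (\<lambda>x. \<Sum>i\<in>UNIV. x $ i * q (axis i 1))"
  proof
    fix x
    have "q x = q (\<Sum>i\<in>UNIV. x $ i *\<^sub>R axis i 1)"
      using basis_expansion[of x] by (simp add: scalar_mult_eq_scaleR)
    then show "q x = (\<Sum>i\<in>UNIV. x $ i * q (axis i 1))" by (simp add: sum scaleR)
  qed
  ultimately show ?case by metis
next
  case (const c)
  then show ?case
    using monomial_span.cmult[OF monomial_span.monom[of "\<lambda>_. 0"], of c] by (simp add: monom_at_zero)
qed (auto intro: monomial_span.add monomial_span_mult)

lemma integrable_real_polynomial_function:
  assumes "\<And>\<alpha>. integrable P (\<lambda>x. monom_at x \<alpha>)" "real_polynomial_function q"
  shows "integrable P q"
  using real_polynomial_function_monomial_span[OF assms(2)]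
  by (induction q rule: monomial_span.induct) (auto simp: assms(1))

section \<open>Difference quotients in the frequency\<close>

lemma scaled_iexp_diff_tendsto:
  "(\<lambda>j. of_nat (Suc j) * (iexp (y / real (Suc j)) - 1)) \<longlonglongrightarrow> \<i> * complex_of_real y"
proof (cases "y = 0")
  case False
  define z where "z = \<i> * complex_of_real y"
  have z: "z \<noteq> 0" using False by (simp add: z_def)
  have "((\<lambda>w. (exp w - 1) / w) \<longlongrightarrow> 1) (at (0::complex))"
    using DERIV_exp[of "0::complex"] by (simp add: DERIV_def)
  moreover have "filterlim (\<lambda>j. z * of_real (1 / real (Suc j))) (at 0) sequentially"
  proof -
    have "(\<lambda>j. z * of_real (1 / real (Suc j))) \<longlonglongrightarrow> z * of_real 0"
      using LIMSEQ_inverse_real_of_nat by (intro tendsto_intros) (simp add: inverse_eq_divide)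
    then show ?thesis using z by (simp add: filterlim_at del: of_nat_Suc)
  qed
  ultimately have "(\<lambda>j. (exp (z * of_real (1 / real (Suc j))) - 1) / (z * of_real (1 / real (Suc j)))) \<longlonglongrightarrow> 1"
    by (rule filterlim_compose)
  then have "(\<lambda>j. z * ((exp (z * of_real (1 / real (Suc j))) - 1) / (z * of_real (1 / real (Suc j))))) \<longlonglongrightarrow> z * 1"
    by (intro tendsto_intros)
  moreover have "z * ((exp (z * of_real (1 / real (Suc j))) - 1) / (z * of_real (1 / real (Suc j))))
      = of_nat (Suc j) * (iexp (y / real (Suc j)) - 1)" for j
    using z by (simp add: z_def field_simps del: of_nat_Suc)
  ultimately show ?thesis by (simp add: z_def)
qed simp

lemma norm_iexp_minus_one_le: "cmod (iexp x - 1) \<le> \<bar>x\<bar>"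
  using norm_iexp_minus_taylor_le[of x 1] by simp

context moment_vector
begin

lemma exp_monom_zero: "exp_monom l (\<lambda>_. 0) = (\<lambda>v. iexp (l \<bullet> X v))"
  by (simp add: exp_monom_def monom_at_zero)

text \<open>
  Difference quotients in the frequency stay in \<open>V\<close>, and their limits carry one more factor
  \<open>X v $ n\<close>.
\<close>

lemma exp_monom_mem_of_open:
  assumes p: "p \<ge> 1" and V: "closed_subspace p M V" and U: "open U" "U \<subseteq> closure S"
    and S: "\<And>l. l \<in> S \<Longrightarrow> (\<lambda>v. iexp (l \<bullet> X v)) \<in> V" and l: "l \<in> U"
  shows "exp_monom l \<alpha> \<in> V"
  using l
proof (induction "\<Sum>i\<in>UNIV. \<alpha> i" arbitrary: \<alpha> l)
  case 0
  then have "\<alpha> = (\<lambda>_. 0)" by auto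
  \<comment> \<open>A point of \<open>U\<close> need not belong to \<open>S\<close>; it is reached
    as a limit, with the constant 1 dominating the exponentials.\<close>
  obtain s where s: "\<And>i. s i \<in> S" "s \<longlonglongrightarrow> l"
    using U(2) 0(2) by (meson closure_sequential subsetD)
  have "(\<lambda>v. iexp (l \<bullet> X v)) \<in> V"
  proof (rule closed_subspace_dominated_limit[OF p V, where h = "\<lambda>i v. iexp (s i \<bullet> X v)" and w = "\<lambda>_. 1"])
    show "(\<lambda>_. 1) \<in> lspace p M"
      by (rule lspace_bounded[OF finite_measure_axioms, where K = 1]) (use p in auto)
    show "AE v in M. (\<lambda>i. iexp (s i \<bullet> X v)) \<longlonglongrightarrow> iexp (l \<bullet> X v)"
      by (intro AE_I2 tendsto_intros s)
  qed (auto intro: S s)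
  then show ?case unfolding \<open>\<alpha> = _\<close> exp_monom_zero .
next
  case (Suc m)
  have "\<exists>n. \<alpha> n \<noteq> 0"
  proof (rule ccontr)
    assume "\<not> ?thesis"
    then show False using Suc.hyps(2) by simp
  qed
  then obtain n where n: "\<alpha> n \<noteq> 0" by blast
  define \<beta> where "\<beta> = \<alpha>(n := \<alpha> n - 1)"
  have \<alpha>: "\<alpha> = (\<lambda>i. (if i = n then 1 else 0) + \<beta> i)" using n by (auto simp: \<beta>_def)
  have "(\<Sum>i\<in>UNIV. \<alpha> i) = 1 + (\<Sum>i\<in>UNIV. \<beta> i)"
    unfolding \<alpha> by (simp only: sum.distrib) simp
  then have "m = (\<Sum>i\<in>UNIV. \<beta> i)" using Suc.hyps(2) by simp
  note IH = Suc.hyps(1)[OF this]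
  obtain e where e: "e > 0" "ball l e \<subseteq> U" using U(1) Suc.prems by (meson open_contains_ball)
  obtain N where N: "inverse (real (Suc N)) < e" using reals_Archimedean[OF e(1)] by blast
  \<comment> \<open>Starting the sequence at \<open>N\<close> keeps the shifted frequencies inside
    \<open>U\<close>, where the induction hypothesis is available.\<close>
  define t where "t = (\<lambda>j. 1 / real (Suc (j + N)))"
  have t: "t j > 0" "t j < e" for j
  proof -
    have "t j \<le> inverse (real (Suc N))" by (simp add: t_def field_simps)
    then show "t j < e" using N by linarith
  qed (simp add: t_def)
  define h where "h = (\<lambda>j v. of_real (1 / t j) * (exp_monom (l + axis n (t j)) \<beta> v - exp_monom l \<beta> v))"
  have h_eq: "h j v = of_real (1 / t j) * (iexp (t j * (X v $ n)) - 1) * exp_monom l \<beta> v" for j v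
    by (simp add: h_def exp_monom_def inner_add_left inner_axis' distrib_left exp_add algebra_simps)
  have \<alpha>_eq: "exp_monom l \<alpha> v = complex_of_real (X v $ n) * exp_monom l \<beta> v" for v
    unfolding \<alpha> exp_monom_def monom_at_add monom_at_single by simp
  \<comment> \<open>The quotients are dominated by the modulus of their own limit, since
    \<open>norm (iexp (t * y) - 1) \<le> t * \<bar>y\<bar>\<close> for positive
    \<open>t\<close>.\<close>
  have "(\<lambda>v. \<i> * exp_monom l \<alpha> v) \<in> V"
  proof (rule closed_subspace_dominated_limit[OF p V, where h = h and w = "exp_monom l \<alpha>"])
    show "exp_monom l \<alpha> \<in> lspace p M" using p by (intro exp_monom_lspace) auto
    show "h j \<in> V" for j
    proof -
      have "l + axis n (t j) \<in> U"
        using e(2) t[of j] by (auto simp: dist_norm norm_eq_sqrt_inner inner_axis_axis subset_eq)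
      then show ?thesis
        unfolding h_def using Suc.prems
        by (intro closed_subspace_cmult[OF V] closed_subspace_diff[OF V] IH)
    qed
    show "AE v in M. (\<lambda>j. h j v) \<longlonglongrightarrow> \<i> * exp_monom l \<alpha> v"
    proof (rule AE_I2)
      fix v
      have "(\<lambda>j. of_nat (Suc (j + N)) * (iexp (X v $ n / real (Suc (j + N))) - 1)) \<longlonglongrightarrow> \<i> * complex_of_real (X v $ n)"
        using LIMSEQ_ignore_initial_segment[OF scaled_iexp_diff_tendsto, of N] by simp
      then have "(\<lambda>j. of_nat (Suc (j + N)) * (iexp (X v $ n / real (Suc (j + N))) - 1) * exp_monom l \<beta> v)
          \<longlonglongrightarrow> \<i> * complex_of_real (X v $ n) * exp_monom l \<beta> v"
        by (intro tendsto_mult_right)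
      then show "(\<lambda>j. h j v) \<longlonglongrightarrow> \<i> * exp_monom l \<alpha> v"
        unfolding h_eq \<alpha>_eq by (simp add: t_def mult.assoc)
    qed
    show "AE v in M. norm (h j v) \<le> norm (exp_monom l \<alpha> v)" for j
    proof (rule AE_I2)
      fix v
      have "norm (h j v) = (1 / t j) * norm (iexp (t j * (X v $ n)) - 1) * norm (exp_monom l \<beta> v)"
        unfolding h_eq norm_mult using t(1)[of j] by (simp add: norm_divide)
      also have "\<dots> \<le> (1 / t j) * \<bar>t j * (X v $ n)\<bar> * norm (exp_monom l \<beta> v)"
        using t(1)[of j] by (intro mult_right_mono mult_left_mono norm_iexp_minus_one_le) auto
      also have "\<dots> = norm (exp_monom l \<alpha> v)"
        unfolding \<alpha>_eq norm_mult using t(1)[of j] by (simp add: abs_mult)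
      finally show "norm (h j v) \<le> norm (exp_monom l \<alpha> v)" .
    qed
  qed measurable
  from closed_subspace_cmult[OF V this, of "- \<i>"] show ?case by (simp add: mult.assoc[symmetric])
qed

end

section \<open>The sum of two measures\<close>

definition measure_plus :: "'a measure \<Rightarrow> 'a measure \<Rightarrow> 'a measure" where
  "measure_plus P Q = measure_of (space P) (sets P) (\<lambda>A. emeasure P A + emeasure Q A)"

lemma sets_measure_plus [simp, measurable_cong]: "sets (measure_plus P Q) = sets P"
  by (simp add: measure_plus_def)

lemma space_measure_plus [simp]: "space (measure_plus P Q) = space P"
  by (simp add: measure_plus_def)

lemma emeasure_measure_plus:
  assumes "sets Q = sets P" "A \<in> sets P"
  shows "emeasure (measure_plus P Q) A = emeasure P A + emeasure Q A"
  unfolding measure_plus_def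
proof (rule emeasure_measure_of_sigma[OF sets.sigma_algebra_axioms _ _ assms(2)])
  show "positive (sets P) (\<lambda>A. emeasure P A + emeasure Q A)" by (simp add: positive_def)
  show "countably_additive (sets P) (\<lambda>A. emeasure P A + emeasure Q A)"
    using assms(1)
    by (auto simp: countably_additive_def suminf_add[symmetric] suminf_emeasure image_subset_iff)
qed

lemma nn_integral_measure_plus:
  assumes Q: "sets Q = sets P" and f: "f \<in> borel_measurable P"
  shows "(\<integral>\<^sup>+ v. f v \<partial>measure_plus P Q) = (\<integral>\<^sup>+ v. f v \<partial>P) + (\<integral>\<^sup>+ v. f v \<partial>Q)"
  using f
proof (induction rule: borel_measurable_induct)
  case (cong f g)
  moreover have "space Q = space P" using Q by (rule sets_eq_imp_space_eq)
  ultimately show ?case by (simp cong: nn_integral_cong_simp)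
next
  case (set A)
  then show ?case using Q by (simp add: emeasure_measure_plus)
next
  case (mult u c)
  then show ?case using Q by (simp add: nn_integral_cmult distrib_left measurable_cong_sets[OF Q refl])
next
  case (add u v)
  then show ?case using Q by (simp add: nn_integral_add measurable_cong_sets[OF Q refl] ac_simps)
next
  case (seq U)
  have U: "U i \<in> borel_measurable Q" "U i \<in> borel_measurable (measure_plus P Q)" for i
    using seq(1) by (simp_all add: measurable_cong_sets[OF Q refl] measurable_cong_sets[OF sets_measure_plus refl])
  have mono: "incseq (\<lambda>i. integral\<^sup>N P (U i))" "incseq (\<lambda>i. integral\<^sup>N Q (U i))"
    using seq(3) by (auto intro!: nn_integral_mono simp: incseq_def le_fun_def)
  show ?case
    using seq U mono
    by (simp add: nn_integral_monotone_convergence_SUP image_image SUP_apply ennreal_SUP_add)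
qed

lemma integrable_measure_plus:
  fixes f :: "'a \<Rightarrow> 'b::{banach, second_countable_topology}"
  assumes Q: "sets Q = sets P"
  shows "integrable (measure_plus P Q) f \<longleftrightarrow> integrable P f \<and> integrable Q f"
proof -
  have "f \<in> borel_measurable (measure_plus P Q) \<longleftrightarrow> f \<in> borel_measurable P"
    "f \<in> borel_measurable Q \<longleftrightarrow> f \<in> borel_measurable P"
    by (simp_all add: measurable_cong_sets[OF Q refl] measurable_cong_sets[OF sets_measure_plus refl])
  then show ?thesis
    using Q by (auto simp: integrable_iff_bounded nn_integral_measure_plus)
qed

text \<open>Nonnegativity allows the identity to be read off from
  \<open>nn_integral_measure_plus\<close>; the integrands in view are even powers and norms.\<close>

lemma integral_measure_plus:
  fixes f :: "'a \<Rightarrow> real"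
  assumes Q: "sets Q = sets P" and f: "integrable P f" "integrable Q f" and nonneg: "\<And>v. f v \<ge> 0"
  shows "(LINT v|measure_plus P Q. f v) = (LINT v|P. f v) + (LINT v|Q. f v)"
proof -
  have "ennreal (LINT v|measure_plus P Q. f v) = ennreal ((LINT v|P. f v) + (LINT v|Q. f v))"
    using f nonneg integrable_measure_plus[OF Q, of f]
    by (simp add: nn_integral_eq_integral[symmetric] nn_integral_measure_plus[OF Q] ennreal_plus)
  then show ?thesis using nonneg by (subst (asm) ennreal_inj) (auto intro!: add_nonneg_nonneg)
qed

section \<open>Density and determinacy\<close>

lemma Lp_norm_eq_lnorm: "Lp_norm p P h = lnorm p P h"
  by (simp add: Lp_norm_def lnorm_def)

lemma real_polynomial_function_monom_at:
  assumes "\<And>i. real_polynomial_function (\<lambda>v. f v $ i)"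
  shows "real_polynomial_function (\<lambda>v. monom_at (f v) \<alpha>)"
  unfolding monom_at_def by (intro real_polynomial_function_prod real_polynomial_function_power assms) auto

locale invariant_generators = linear_group G
  for G :: "(real ^ 'm ^ 'm) set" +
  fixes f :: "real ^ 'm \<Rightarrow> real ^ 'n"
  assumes f_mem: "\<And>n. (\<lambda>v. f v $ n) \<in> real_invariant_polys G"
    and f_generates: "generates_invariants G f UNIV"
begin

lemma f_invariant: "g \<in> G \<Longrightarrow> f (g *v v) = f v"
  using f_mem by (simp add: real_invariant_polys_def invariant_fun_iff vec_eq_iff)

lemma f_polynomial: "real_polynomial_function (\<lambda>v. f v $ n)"
  using f_mem by (simp add: real_invariant_polys_def)

lemma f_continuous: "continuous_on S f"
proof -
  have "continuous_on S (\<lambda>v. \<chi> n. f v $ n)"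
    using f_polynomial by (intro continuous_on_vec_lambda continuous_on_polymonial_function)
      (simp add: real_polynomial_function_eq)
  then show ?thesis by simp
qed

lemma f_measurable: "sets P = sets borel \<Longrightarrow> f \<in> borel_measurable P"
  using borel_measurable_continuous_onI[OF f_continuous] measurable_cong_sets[OF _ refl, of P borel] by blast

section \<open>Density for a fixed invariant measure with finite moments\<close>

context
  fixes P :: "(real ^ 'm) measure"
  assumes P: "P \<in> invariant_moment_measures G"
begin

lemma sets_P: "sets P = sets borel"
  using P by (simp add: invariant_moment_measures_def)

lemma space_P: "space P = UNIV"
  using sets_eq_imp_space_eq[OF sets_P] by simp

lemma emeasure_act:
  assumes "g \<in> G" "B \<in> sets borel"
  shows "emeasure P ((\<lambda>v. g *v v) -` B) = emeasure P B"
proof -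
  have "(\<lambda>v. matrix_inv g *v v) ` B = (\<lambda>v. g *v v) -` B"
  proof
    show "(\<lambda>v. g *v v) -` B \<subseteq> (\<lambda>v. matrix_inv g *v v) ` B"
      using assms(1) by (auto intro!: image_eqI[of _ _ "g *v _"])
  qed (use assms(1) in auto)
  moreover have "emeasure P ((\<lambda>v. matrix_inv g *v v) ` B) = emeasure P B"
    using P assms unfolding invariant_moment_measures_def invariant_measure_def by blast
  ultimately show ?thesis by simp
qed

lemma integrable_polynomial: "real_polynomial_function q \<Longrightarrow> integrable P q"
  by (rule integrable_real_polynomial_function) (use P in \<open>auto simp: invariant_moment_measures_def\<close>)

lemma finite_measure_P: "finite_measure P"
proof (rule finite_measureI)
  have "integrable P (\<lambda>_. 1 :: real)" by (intro integrable_polynomial real_polynomial_function.intros(2))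
  then show "emeasure P (space P) \<noteq> \<infinity>"
    by (simp add: integrable_iff_bounded less_top)
qed

lemma moment_vector_f: "moment_vector P f"
proof -
  interpret finite_measure P by (rule finite_measure_P)
  show ?thesis
    by unfold_locales
      (intro f_measurable sets_P integrable_polynomial real_polynomial_function_monom_at f_polynomial)+
qed

interpretation mv: moment_vector P f by (rule moment_vector_f)

lemma Lp_invariantI:
  assumes "h \<in> lspace p P" "invariant_fun G h"
  shows "h \<in> Lp_invariant G p P"
  using assms inv_mem by (auto simp: Lp_invariant_def lspace_def invariant_fun_iff)

text \<open>The base frequency is left free: polynomials and determinacy use 0, the exponentials use
  an interior point of the closure of \<open>S\<close>.\<close>

lemma Lp_invariant_subset:
  assumes carl: "\<And>n. carleman (\<lambda>k. LINT v|P. (f v $ n) ^ k)"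
    and p: "p \<ge> 1" and V: "closed_subspace p P V" and base: "\<And>\<alpha>. mv.exp_monom l0 \<alpha> \<in> V"
  shows "Lp_invariant G p P \<subseteq> V"
proof
  fix h assume h: "h \<in> Lp_invariant G p P"
  have "(\<lambda>v. iexp (l \<bullet> f v)) \<in> V" for l
    using mv.exp_monom_mem[OF p V carl base, of l "\<lambda>_. 0"] unfolding mv.exp_monom_zero .
  then interpret exp_subspace P f p V
    by unfold_locales (use p V in auto)
  show "h \<in> V"
  proof (rule Lp_invariant_mem[OF finite_measure_P sets_P p V _ h])
    show "(\<lambda>v. complex_of_real (indicator A v)) \<in> V" if "A \<in> invariant_sets" for A
    proof (rule indicator_invariant_mem[OF finite_measure_P sets_P f_continuous _ f_generates p V _ that])
      show "invariant_fun G f" by (simp add: invariant_fun_iff f_invariant)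
      show "(\<lambda>v. complex_of_real (indicator (f -` C) v)) \<in> V" if "C \<in> sets borel" for C
        using indicator_vimage_mem[OF that] by (simp add: space_P)
    qed
  qed
qed

lemma dense_in_Lp_invariantI:
  assumes p: "p \<ge> 1" and carl: "\<And>n. carleman (\<lambda>k. LINT v|P. (f v $ n) ^ k)"
    and D: "\<And>h. h \<in> D \<Longrightarrow> h \<in> lspace p P" "\<And>h. h \<in> D \<Longrightarrow> invariant_fun G h" "(\<lambda>v. 0) \<in> D"
    "\<And>h k. h \<in> D \<Longrightarrow> k \<in> D \<Longrightarrow> (\<lambda>v. h v + k v) \<in> D" "\<And>c h. h \<in> D \<Longrightarrow> (\<lambda>v. c * h v) \<in> D"
    and base: "\<And>\<alpha>. closed_subspace p P (lclosure p P D) \<Longrightarrow> D \<subseteq> lclosure p P D \<Longrightarrow>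
      mv.exp_monom l0 \<alpha> \<in> lclosure p P D"
  shows "dense_in_Lp_invariant G p P D"
proof -
  have "D \<subseteq> lspace p P" using D(1) by auto
  note closed = closed_subspace_lclosure[OF p this D(3-5)] and sup = lclosure_superset[OF this]
  have "Lp_invariant G p P \<subseteq> lclosure p P D"
    by (rule Lp_invariant_subset[OF carl p closed base[OF closed sup]])
  then show ?thesis
    using D(1,2) by (auto simp: dense_in_Lp_invariant_def Lp_norm_eq_lnorm lclosure_def intro!: Lp_invariantI)
qed

text \<open>The power \<open>norm (h v) powr p\<close> is the power \<open>p / 2\<close> of the real
  polynomial \<open>a\<^sup>2 + b\<^sup>2\<close>, whose integer powers are integrable
  polynomials.\<close>

lemma polynomial_lspace:
  fixes h :: "real ^ 'm \<Rightarrow> complex"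
  assumes "polynomial_function h" "p > 0"
  shows "h \<in> lspace p P"
proof -
  obtain a b where a: "real_polynomial_function a" and b: "real_polynomial_function b"
    and h: "h = (\<lambda>v. complex_of_real (a v) + \<i> * complex_of_real (b v))"
    using assms(1) unfolding polynomial_function_complex_iff by blast
  have m: "h \<in> borel_measurable P"
    using borel_measurable_continuous_onI[OF continuous_on_polymonial_function[OF assms(1)]]
    unfolding measurable_cong_sets[OF sets_P refl] .
  have q: "real_polynomial_function (\<lambda>v. a v ^ 2 + b v ^ 2)"
    using a b by (intro real_polynomial_function.intros(3) real_polynomial_function_power)
  have "integrable P (\<lambda>v. \<bar>a v ^ 2 + b v ^ 2\<bar> powr (p / 2))"
    using assms(2) q integrable_polynomial[OF q]
    by (intro integrable_powr_of_even_powers finite_measure_P integrable_polynomial real_polynomial_function_power) auto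
  moreover have "\<bar>a v ^ 2 + b v ^ 2\<bar> powr (p / 2) = norm (h v) powr p" for v
    by (simp add: h cmod_def powr_half_sqrt[symmetric] powr_powr)
  ultimately show ?thesis using m by (simp add: lspace_def)
qed

lemma dense_complex_invariant_polys:
  assumes p: "p \<ge> 1" and carl: "\<And>n. carleman (\<lambda>k. LINT v|P. (f v $ n) ^ k)"
  shows "dense_in_Lp_invariant G p P (complex_invariant_polys G)"
proof (rule dense_in_Lp_invariantI[OF p carl])
  show "h \<in> lspace p P" if "h \<in> complex_invariant_polys G" for h
    using that p by (intro polynomial_lspace) (auto simp: complex_invariant_polys_def)
  show "(\<lambda>v. c * h v) \<in> complex_invariant_polys G" if "h \<in> complex_invariant_polys G" for c h
  proof -
    have "polynomial_function (\<lambda>v. c * h v)"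
      unfolding polynomial_function_def o_def
    proof (intro allI impI)
      fix T :: "complex \<Rightarrow> real" assume "bounded_linear T"
      then have "bounded_linear (\<lambda>z. T (c * z))"
        using bounded_linear_compose bounded_linear_mult_right by blast
      then show "real_polynomial_function (\<lambda>v. T (c * h v))"
        using that by (auto simp: complex_invariant_polys_def polynomial_function_def o_def)
    qed
    then show ?thesis using that by (simp add: complex_invariant_polys_def invariant_fun_def)
  qed
  show "mv.exp_monom 0 \<alpha> \<in> lclosure p P (complex_invariant_polys G)"
    if "complex_invariant_polys G \<subseteq> lclosure p P (complex_invariant_polys G)" for \<alpha>
  proof -
    have "real_polynomial_function (\<lambda>v. monom_at (f v) \<alpha>)"
      by (intro real_polynomial_function_monom_at f_polynomial)
    then have "polynomial_function (\<lambda>v. complex_of_real (monom_at (f v) \<alpha>))"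
      unfolding polynomial_function_complex_iff
      by (intro exI[of _ "\<lambda>v. monom_at (f v) \<alpha>"] exI[of _ "\<lambda>_. 0"]) auto
    then have "mv.exp_monom 0 \<alpha> \<in> complex_invariant_polys G"
      by (simp add: mv.exp_monom_def complex_invariant_polys_def invariant_fun_iff f_invariant)
    then show ?thesis using that by blast
  qed
qed (auto simp: complex_invariant_polys_def invariant_fun_def)

lemma exp_spanI:
  "finite T \<Longrightarrow> T \<subseteq> S \<Longrightarrow> (\<lambda>v. \<Sum>l\<in>T. c l * iexp (l \<bullet> f v)) \<in> exp_span f S"
  unfolding exp_span_def by blast

lemma exp_span_add:
  assumes "h \<in> exp_span f S" "k \<in> exp_span f S"
  shows "(\<lambda>v. h v + k v) \<in> exp_span f S"
proof -
  obtain T c where T: "finite T" "T \<subseteq> S" "h = (\<lambda>v. \<Sum>l\<in>T. c l * iexp (l \<bullet> f v))"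
    using assms(1) unfolding exp_span_def by blast
  obtain U d where U: "finite U" "U \<subseteq> S" "k = (\<lambda>v. \<Sum>l\<in>U. d l * iexp (l \<bullet> f v))"
    using assms(2) unfolding exp_span_def by blast
  \<comment> \<open>Both coefficient families are extended by 0, so that frequencies common to
    \<open>T\<close> and \<open>U\<close> receive the sum.\<close>
  define b where "b = (\<lambda>l. (if l \<in> T then c l else 0) + (if l \<in> U then d l else 0))"
  have "(\<Sum>l\<in>T \<union> U. b l * iexp (l \<bullet> f v)) = h v + k v" for v
  proof -
    have "(\<Sum>l\<in>T \<union> U. b l * iexp (l \<bullet> f v))
        = (\<Sum>l\<in>T \<union> U. if l \<in> T then c l * iexp (l \<bullet> f v) else 0)
          + (\<Sum>l\<in>T \<union> U. if l \<in> U then d l * iexp (l \<bullet> f v) else 0)"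
      unfolding sum.distrib[symmetric] by (intro sum.cong) (auto simp: b_def distrib_right)
    also have "\<dots> = h v + k v"
      unfolding T(3) U(3) using T(1) U(1)
      by (intro arg_cong2[where f = "(+)"] sum.mono_neutral_cong_right) auto
    finally show ?thesis .
  qed
  then show ?thesis using exp_spanI[of "T \<union> U" S b] T U by simp
qed

lemma dense_exp_span:
  assumes p: "p \<ge> 1" and carl: "\<And>n. carleman (\<lambda>k. LINT v|P. (f v $ n) ^ k)"
    and S: "somewhere_dense S"
  shows "dense_in_Lp_invariant G p P (exp_span f S)"
proof -
  obtain l0 where l0: "l0 \<in> interior (closure S)" using S by (auto simp: somewhere_dense_def)
  show ?thesis
  proof (rule dense_in_Lp_invariantI[OF p carl])
    show "h \<in> lspace p P" if h: "h \<in> exp_span f S" for h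
    proof -
      obtain T c where T: "finite T" "T \<subseteq> S" "h = (\<lambda>v. \<Sum>l\<in>T. c l * iexp (l \<bullet> f v))"
        using h unfolding exp_span_def by blast
      have "(\<lambda>v. iexp (l \<bullet> f v)) \<in> lspace p P" for l
        using mv.exp_monom_lspace[of p l "\<lambda>_. 0"] p unfolding mv.exp_monom_zero by simp
      then show ?thesis unfolding T(3) using p by (intro lspace_sum lspace_cmult) auto
    qed
    show "invariant_fun G h" if "h \<in> exp_span f S" for h
      using that by (auto simp: exp_span_def invariant_fun_iff f_invariant)
    show "(\<lambda>v. 0) \<in> exp_span f S" using exp_spanI[of "{}"] by simp
    show "(\<lambda>v. h v + k v) \<in> exp_span f S" if "h \<in> exp_span f S" "k \<in> exp_span f S" for h k
      using that by (rule exp_span_add)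
    show "(\<lambda>v. a * h v) \<in> exp_span f S" if h: "h \<in> exp_span f S" for a h
    proof -
      obtain T c where T: "finite T" "T \<subseteq> S" "h = (\<lambda>v. \<Sum>l\<in>T. c l * iexp (l \<bullet> f v))"
        using h unfolding exp_span_def by blast
      then show ?thesis using exp_spanI[OF T(1,2), of "\<lambda>l. a * c l"] by (simp add: sum_distrib_left mult.assoc)
    qed
    show "mv.exp_monom l0 \<alpha> \<in> lclosure p P (exp_span f S)"
      if V: "closed_subspace p P (lclosure p P (exp_span f S))"
        and sup: "exp_span f S \<subseteq> lclosure p P (exp_span f S)" for \<alpha>
    proof (rule mv.exp_monom_mem_of_open[OF p V open_interior interior_subset _ l0])
      show "(\<lambda>v. iexp (l \<bullet> f v)) \<in> lclosure p P (exp_span f S)" if "l \<in> S" for l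
        using exp_spanI[of "{l}" S "\<lambda>_. 1"] that sup by auto
    qed
  qed
qed

end

section \<open>Determinacy by means of the sum of two measures\<close>

lemma measure_plus_mem:
  assumes P: "P \<in> invariant_moment_measures G" and Q: "Q \<in> invariant_moment_measures G"
  shows "measure_plus P Q \<in> invariant_moment_measures G"
proof -
  have sets: "sets Q = sets P" "sets P = sets borel" using sets_P[OF P] sets_P[OF Q] by auto
  have "(\<lambda>v. matrix_inv g *v v) ` B \<in> sets borel" if "g \<in> G" "B \<in> sets borel" for g B
  proof -
    have "(\<lambda>v. matrix_inv g *v v) ` B = (\<lambda>v. g *v v) -` B \<inter> space borel"
    proof
      show "(\<lambda>v. g *v v) -` B \<inter> space borel \<subseteq> (\<lambda>v. matrix_inv g *v v) ` B"
        using that(1) by (auto intro!: image_eqI[of _ _ "g *v _"])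
    qed (use that(1) in auto)
    then show ?thesis using measurable_sets[OF measurable_act that(2)] by simp
  qed
  then show ?thesis
    using P Q sets
    by (auto simp: invariant_moment_measures_def invariant_measure_def emeasure_measure_plus integrable_measure_plus)
qed

text \<open>
  If the moments agree, the functions with the same integral against \<open>P\<close> and \<open>Q\<close> form a closed
  subspace of the integrable functions for \<open>P + Q\<close>, and \<open>P + Q\<close> inherits Carleman's condition.
\<close>

lemma G_determinateI:
  assumes P: "P \<in> invariant_moment_measures G"
    and carl: "\<And>n. carleman (\<lambda>k. LINT v|P. (f v $ n) ^ k)"
  shows "G_determinate G f P"
  unfolding G_determinate_def
proof (intro conjI P ballI impI)
  fix Q assume Q: "Q \<in> invariant_moment_measures G"
    and "\<forall>\<alpha>. invariant_moment f Q \<alpha> = invariant_moment f P \<alpha>"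
  then have mom: "(LINT v|Q. monom_at (f v) \<alpha>) = (LINT v|P. monom_at (f v) \<alpha>)" for \<alpha>
    by (simp add: invariant_moment_def)
  define R where "R = measure_plus P Q"
  have R: "R \<in> invariant_moment_measures G" unfolding R_def by (rule measure_plus_mem[OF P Q])
  have sets: "sets Q = sets P" "sets P = sets borel" using sets_P[OF P] sets_P[OF Q] by auto
  have integrable_R: "integrable R h \<longleftrightarrow> integrable P h \<and> integrable Q h"
    for h :: "real ^ 'm \<Rightarrow> 'b::{banach, second_countable_topology}"
    unfolding R_def by (rule integrable_measure_plus[OF sets(1)])
  have carl_R: "carleman (\<lambda>k. LINT v|R. (f v $ n) ^ k)" for n
  proof -
    \<comment> \<open>Carleman's condition involves only even powers, which are nonnegative, as
      \<open>integral_measure_plus\<close> requires.\<close>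
    have eq: "(LINT v|R. (f v $ n) ^ (2 * k)) = 2 * (LINT v|P. (f v $ n) ^ (2 * k))" for k
    proof -
      have int: "integrable R (\<lambda>v. (f v $ n) ^ (2 * k))"
        by (intro integrable_polynomial[OF R] real_polynomial_function_power f_polynomial)
      have "(LINT v|R. (f v $ n) ^ (2 * k)) = (LINT v|P. (f v $ n) ^ (2 * k)) + (LINT v|Q. (f v $ n) ^ (2 * k))"
        using int unfolding integrable_R unfolding R_def by (intro integral_measure_plus sets) auto
      then show ?thesis
        using mom[of "\<lambda>i. if i = n then 2 * k else 0"] by (simp add: monom_at_single)
    qed
    show ?thesis
    proof (rule carleman_mono_factor[OF carl[of n], where c = 2])
      have nonneg: "0 \<le> (LINT v|M. (f v $ n) ^ (2 * k))" for M k
        by (intro Bochner_Integration.integral_nonneg zero_le_even_power) simp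
      show "0 \<le> (LINT v|P. (f v $ n) ^ (2 * Suc k))" "0 \<le> (LINT v|R. (f v $ n) ^ (2 * Suc k))" for k
        by (rule nonneg)+
      show "(LINT v|R. (f v $ n) ^ (2 * Suc k)) \<le> 2 * (LINT v|P. (f v $ n) ^ (2 * Suc k))" for k
        by (simp only: eq order_refl)
    qed simp
  qed
  define V where "V = {h \<in> lspace 1 R. integral\<^sup>L P h = integral\<^sup>L Q h}"
  have V_int: "integrable P h" "integrable Q h" if "h \<in> lspace 1 R" for h
  proof -
    have "integrable R h" using that integrable_norm_iff[of h R] by (auto simp: lspace_def)
    then show "integrable P h" "integrable Q h" by (simp_all add: integrable_R)
  qed
  have V: "closed_subspace 1 R V"
    unfolding closed_subspace_def
  proof (intro conjI ballI allI impI)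
    fix h assume h: "h \<in> lspace 1 R" and *: "\<forall>\<epsilon>>0. \<exists>q\<in>V. lnorm 1 R (\<lambda>v. h v - q v) < \<epsilon>"
    \<comment> \<open>Both functionals are continuous for the norm of L_1 with respect to
      \<open>R\<close>: the integrals of \<open>norm d\<close> for \<open>P\<close> and
      \<open>Q\<close> add up to that norm. So their difference vanishes on limits.\<close>
    have small: "norm (integral\<^sup>L P h - integral\<^sup>L Q h) \<le> \<epsilon>" if \<epsilon>: "\<epsilon> > 0" for \<epsilon>
    proof -
      obtain q where q: "q \<in> V" "lnorm 1 R (\<lambda>v. h v - q v) < \<epsilon>" using * \<epsilon> by blast
      have q1: "q \<in> lspace 1 R" using q(1) by (simp add: V_def)
      define d where "d = (\<lambda>v. h v - q v)"
      have d: "integrable P d" "integrable Q d"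
        unfolding d_def using V_int[OF h] V_int[OF q1] by auto
      have "integral\<^sup>L P h - integral\<^sup>L Q h = integral\<^sup>L P d - integral\<^sup>L Q d"
        unfolding d_def using V_int[OF h] V_int[OF q1] q(1) by (simp add: V_def)
      also have "norm \<dots> \<le> norm (integral\<^sup>L P d) + norm (integral\<^sup>L Q d)"
        by (rule norm_triangle_ineq4)
      also have "\<dots> \<le> (LINT v|P. norm (d v)) + (LINT v|Q. norm (d v))"
        by (intro add_mono integral_norm_bound)
      also have "\<dots> = (LINT v|R. norm (d v))"
        unfolding R_def using d by (intro integral_measure_plus[symmetric] sets) auto
      also have "\<dots> = lnorm 1 R d" by (simp add: lnorm_def)
      also have "\<dots> \<le> \<epsilon>" using q(2) by (simp add: d_def)
      finally show ?thesis .
    qed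
    have "norm (integral\<^sup>L P h - integral\<^sup>L Q h) \<le> 0"
    proof (rule field_le_epsilon)
      fix e :: real assume "e > 0"
      then show "norm (integral\<^sup>L P h - integral\<^sup>L Q h) \<le> 0 + e" using small[of e] by linarith
    qed
    then show "h \<in> V" using h by (simp add: V_def)
  next
    fix h k assume "h \<in> V" "k \<in> V"
    then have h: "h \<in> lspace 1 R" "integral\<^sup>L P h = integral\<^sup>L Q h"
      and k: "k \<in> lspace 1 R" "integral\<^sup>L P k = integral\<^sup>L Q k" by (auto simp: V_def)
    have "(\<lambda>v. h v + k v) \<in> lspace 1 R" using h k by (intro lspace_add) auto
    then show "(\<lambda>v. h v + k v) \<in> V"
      using h(2) k(2) V_int[OF h(1)] V_int[OF k(1)] by (simp add: V_def)
  next
    fix c h assume "h \<in> V"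
    then have h: "h \<in> lspace 1 R" "integral\<^sup>L P h = integral\<^sup>L Q h" by (auto simp: V_def)
    have "(\<lambda>v. c * h v) \<in> lspace 1 R" using h(1) by (intro lspace_cmult) auto
    then show "(\<lambda>v. c * h v) \<in> V" using h(2) by (simp add: V_def)
  qed (auto simp: V_def lspace_zero)
  interpret mv: moment_vector R f by (rule moment_vector_f[OF R])
  \<comment> \<open>At frequency 0 this is the monomial in \<open>f\<close>, and membership says
    that its two moments agree.\<close>
  have "mv.exp_monom 0 \<alpha> \<in> V" for \<alpha>
    using mom[of \<alpha>] mv.exp_monom_lspace[of 1 0 \<alpha>] by (simp add: V_def mv.exp_monom_def)
  then have sub: "Lp_invariant G 1 R \<subseteq> V" by (intro Lp_invariant_subset[OF R carl_R _ V]) auto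
  show "Q = P"
  proof (rule measure_eqI)
    show "sets Q = sets P" by (rule sets)
    fix B assume "B \<in> sets Q"
    then have B: "B \<in> sets borel" using sets by simp
    \<comment> \<open>The set \<open>B\<close> need not be invariant, but this sum over the group
      is. By invariance of the measures each summand contributes the measure of \<open>B\<close>, so
      equal integrals of \<open>h\<close> give equal measures.\<close>
    define h where "h = (\<lambda>v. \<Sum>g\<in>G. complex_of_real (indicator B (g *v v)))"
    have gB: "(\<lambda>v. g *v v) -` B \<in> sets borel" for g :: "real ^ 'm ^ 'm"
      using measurable_sets[OF measurable_act B, of g] by simp
    have h_eq: "h = (\<lambda>v. \<Sum>g\<in>G. complex_of_real (indicator ((\<lambda>v. g *v v) -` B) v))"
      by (auto simp: h_def indicator_def)
    have int: "integral\<^sup>L M h = complex_of_real (card G * measure M B)"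
      if M: "M \<in> invariant_moment_measures G" for M
    proof -
      interpret finite_measure M by (rule finite_measure_P[OF M])
      have "integral\<^sup>L M h = (\<Sum>g\<in>G. complex_of_real (measure M ((\<lambda>v. g *v v) -` B)))"
        unfolding h_eq using gB sets_P[OF M]
        by (subst Bochner_Integration.integral_sum) (auto simp: space_P[OF M] emeasure_eq_measure)
      also have "\<dots> = (\<Sum>g\<in>G. complex_of_real (measure M B))"
        using emeasure_act[OF M _ B] by (intro sum.cong) (auto simp: measure_def)
      finally show ?thesis by simp
    qed
    have "h \<in> lspace 1 R"
      unfolding h_eq
    proof (intro lspace_sum)
      fix g
      have [measurable]: "(\<lambda>v. g *v v) -` B \<in> sets R" using gB sets_P[OF R] by simp
      have "(\<lambda>v. complex_of_real (indicator ((\<lambda>v. g *v v) -` B) v)) \<in> borel_measurable R"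
        by measurable
      then show "(\<lambda>v. complex_of_real (indicator ((\<lambda>v. g *v v) -` B) v)) \<in> lspace 1 R"
        by (rule lspace_bounded[OF finite_measure_P[OF R], where K = 1, rotated]) (auto simp: indicator_def)
    qed auto
    moreover have "invariant_fun G h" unfolding h_def by (rule invariant_fun_sum)
    ultimately have "h \<in> V" using sub Lp_invariantI[OF R] by blast
    then have "card G * measure P B = card G * measure Q B"
      using int[OF P] int[OF Q] by (simp add: V_def del: of_real_mult)
    moreover have "card G \<noteq> 0" using finite_G one_mem by auto
    ultimately show "emeasure Q B = emeasure P B"
      using finite_measure.emeasure_eq_measure[OF finite_measure_P[OF P]]
        finite_measure.emeasure_eq_measure[OF finite_measure_P[OF Q]] by simp
  qed
qed

end

theorem theorem1:
  fixes G :: "(real ^ 'm ^ 'm) set"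
    and f :: "real ^ 'm \<Rightarrow> real ^ 'n"
    and P :: "(real ^ 'm) measure"
  assumes "finite_linear_group G"
    and "minimal_generators G f"
    and "P \<in> invariant_moment_measures G"
    and "\<And>n. carleman (\<lambda>k. LINT v|P. (f v $ n) ^ k)"
  shows "G_determinate G f P \<and>
    (\<forall>p\<ge>1. dense_in_Lp_invariant G p P (complex_invariant_polys G)) \<and>
    (\<forall>p\<ge>1. \<forall>S. somewhere_dense S \<longrightarrow> dense_in_Lp_invariant G p P (exp_span f S))"
proof -
  interpret invariant_generators G f
    using assms(1,2) by unfold_locales (auto simp: minimal_generators_def)
  show ?thesis
    using G_determinateI dense_complex_invariant_polys dense_exp_span assms(3,4) by blast
qed

end
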